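(* For any integer $m\geq 2$, the curve $$C'':\ F''=yz(x^my^m+y^mz^m+x^mz^m)(y^m+z^m)=0$$ in $\mathbb{P}^2$ is supersolvable. In particular, the complement $M(C'')=\mathbb{P}^2\setminus C''$ is a $K(\pi,1)$ space.
   Context: For a reduced curve $D$ in the complex projective plane $\mathbb{P}^2$ and a point $p\in D$, $p$ is a modular point for $D$ if the central projection $\pi_p:\mathbb{P}^2\setminus\{p\}\to\mathbb{P}^1$ induces a locally trivial fibration of the complement $M(D)=\mathbb{P}^2\setminus D$. This happens if and only if for any line $L_p$ passing through $p$ and not an irreducible component of $D$ one has $(D,L_p)_p=\operatorname{mult}_p(D)$ and $(D,L_p)_q=1$ for any $q\in D\cap L_p$, $q\neq p$, where $(\cdot,\cdot)_q$ denotes intersection multiplicity. The curve $D$ is supersolvable if it has at least one modular point. *)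

theory Defs
  imports
    "HOL-Analysis.Analysis"
    "HOL-Computational_Algebra.Polynomial"
    "HOL-Computational_Algebra.Squarefree"
begin

section \<open>Complex projective space\<close>

text \<open>
  The projective space of \<open>complex ^ 'n\<close> is the set of its one-dimensional complex subspaces;
  thus \<open>3 cproj\<close> is the complex projective plane and \<open>2 cproj\<close> the complex projective line.
\<close>

typedef (overloaded) ('n::finite) cproj =
  "{L :: (complex ^ 'n) set. \<exists>v. v \<noteq> 0 \<and> L = range (\<lambda>c. c *s v)}"
proof -
  have "(\<chi> i. 1) \<noteq> (0 :: complex ^ 'n)"
    by (simp add: vec_eq_iff)
  then show ?thesis by blast
qed

text \<open>\<open>proj v\<close> is the point with homogeneous coordinates \<open>v\<close>; it is meaningful only for \<open>v \<noteq> 0\<close>.\<close>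

definition proj :: "complex ^ 'n::finite \<Rightarrow> 'n cproj" where
  "proj v = Abs_cproj (range (\<lambda>c. c *s v))"

text \<open>Quotient topology; the punctured space is open, so openness in it is openness.\<close>

instantiation cproj :: (finite) topological_space
begin

definition open_cproj :: "'a cproj set \<Rightarrow> bool" where
  "open_cproj U \<longleftrightarrow> open {v. v \<noteq> 0 \<and> proj v \<in> U}"

instance
proof
  have "{v :: complex ^ 'a. v \<noteq> 0 \<and> proj v \<in> UNIV} = - {0}" by auto
  then show "open (UNIV :: 'a cproj set)"
    by (simp add: open_cproj_def open_Compl)
next
  fix S T :: "'a cproj set"
  assume "open S" "open T"
  then have "open ({v. v \<noteq> 0 \<and> proj v \<in> S} \<inter> {v. v \<noteq> 0 \<and> proj v \<in> T})"
    unfolding open_cproj_def by (rule open_Int)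
  moreover have "{v. v \<noteq> 0 \<and> proj v \<in> S} \<inter> {v. v \<noteq> 0 \<and> proj v \<in> T}
      = {v. v \<noteq> 0 \<and> proj v \<in> S \<inter> T}" by auto
  ultimately show "open (S \<inter> T)" by (simp add: open_cproj_def)
next
  fix K :: "'a cproj set set"
  assume "\<forall>S\<in>K. open S"
  then have "open (\<Union>S\<in>K. {v. v \<noteq> 0 \<and> proj v \<in> S})"
    unfolding open_cproj_def by blast
  moreover have "(\<Union>S\<in>K. {v. v \<noteq> 0 \<and> proj v \<in> S}) = {v. v \<noteq> 0 \<and> proj v \<in> \<Union>K}" by auto
  ultimately show "open (\<Union>K)" by (simp add: open_cproj_def)
qed

end

section \<open>Plane curves\<close>

text \<open>
  The ring \<open>\<complex>[x,y,z]\<close> is represented by iterated univariate polynomials, with \<open>x\<close> as the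
  outermost and \<open>z\<close> as the innermost variable.
\<close>

type_synonym cpoly3 = "complex poly poly poly"

definition varX :: cpoly3 where "varX = [:0, 1:]"
definition varY :: cpoly3 where "varY = [:[:0, 1:]:]"
definition varZ :: cpoly3 where "varZ = [:[:[:0, 1:]:]:]"

definition eval3 :: "cpoly3 \<Rightarrow> complex ^ 3 \<Rightarrow> complex" where
  "eval3 F v = poly (poly (poly F [:[:v $ 1:]:]) [:v $ 2:]) (v $ 3)"

lemma eval3_simps [simp]:
  "eval3 varX v = v $ 1" "eval3 varY v = v $ 2" "eval3 varZ v = v $ 3"
  "eval3 [:[:[:c:]:]:] v = c"
  "eval3 (F + G) v = eval3 F v + eval3 G v"
  "eval3 (F * G) v = eval3 F v * eval3 G v"
  "eval3 (F ^ k) v = eval3 F v ^ k"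
  by (simp_all add: eval3_def varX_def varY_def varZ_def)

definition homogeneous3 :: "nat \<Rightarrow> cpoly3 \<Rightarrow> bool" where
  "homogeneous3 d F \<longleftrightarrow> (\<forall>i j k. coeff (coeff (coeff F i) j) k \<noteq> 0 \<longrightarrow> i + j + k = d)"

text \<open>
  A reduced plane curve is given by a homogeneous polynomial of positive degree without multiple
  factors. (The predicate \<open>squarefree\<close> excludes the zero polynomial.)
\<close>

definition reduced_plane_curve :: "cpoly3 \<Rightarrow> bool" where
  "reduced_plane_curve F \<longleftrightarrow> (\<exists>d>0. homogeneous3 d F) \<and> squarefree F"

definition curve :: "cpoly3 \<Rightarrow> 3 cproj set" where
  "curve F = {proj v | v. v \<noteq> 0 \<and> eval3 F v = 0}"

definition curve_complement :: "cpoly3 \<Rightarrow> 3 cproj set" where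
  "curve_complement F = - curve F"

section \<open>Modular points and supersolvable curves\<close>

text \<open>
  The central projection from \<open>p\<close> is induced by a linear map \<open>\<complex>\<^sup>3 \<rightarrow> \<complex>\<^sup>2\<close> whose kernel is the line
  \<open>p\<close>. It is determined up to a projective automorphism of the target, i.e. up to the
  identification of the pencil of lines through \<open>p\<close> with the projective line. The value
  at \<open>p\<close> itself is irrelevant.
\<close>

definition central_projection :: "3 cproj \<Rightarrow> (3 cproj \<Rightarrow> 2 cproj) \<Rightarrow> bool" where
  "central_projection p \<pi> \<longleftrightarrow>
    (\<exists>A :: complex ^ 3 ^ 2.
      (\<forall>v. A *v v = 0 \<longleftrightarrow> v \<in> Rep_cproj p) \<and>
      (\<forall>v. v \<notin> Rep_cproj p \<longrightarrow> \<pi> (proj v) = proj (A *v v)))"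

text \<open>
  In a local trivialization the model fibre may always be taken to be the fibre over the point
  under consideration.
\<close>

definition locally_trivial_fibration :: "'a topology \<Rightarrow> 'b topology \<Rightarrow> ('a \<Rightarrow> 'b) \<Rightarrow> bool" where
  "locally_trivial_fibration E B \<pi> \<longleftrightarrow>
    continuous_map E B \<pi> \<and> \<pi> ` topspace E = topspace B \<and>
    (\<forall>b\<in>topspace B. \<exists>U \<phi>. openin B U \<and> b \<in> U \<and>
      homeomorphic_map
        (prod_topology (subtopology B U) (subtopology E {e \<in> topspace E. \<pi> e = b}))
        (subtopology E {e \<in> topspace E. \<pi> e \<in> U}) \<phi> \<and>
      (\<forall>u\<in>U. \<forall>e\<in>topspace E. \<pi> e = b \<longrightarrow> \<pi> (\<phi> (u, e)) = u))"

text \<open>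
  The base of the fibration is the image of the complement: the projective line without the
  points that correspond to lines through \<open>p\<close> contained in the curve.
\<close>

definition modular_point :: "cpoly3 \<Rightarrow> 3 cproj \<Rightarrow> bool" where
  "modular_point F p \<longleftrightarrow> p \<in> curve F \<and>
    (\<exists>\<pi>. central_projection p \<pi> \<and>
      locally_trivial_fibration (top_of_set (curve_complement F))
        (top_of_set (\<pi> ` curve_complement F)) \<pi>)"

definition supersolvable :: "cpoly3 \<Rightarrow> bool" where
  "supersolvable F \<longleftrightarrow> reduced_plane_curve F \<and> (\<exists>p. modular_point F p)"

section \<open>Spaces of type K(pi,1)\<close>

definition cube :: "nat \<Rightarrow> (nat \<Rightarrow> real) topology" where
  "cube n = product_topology (\<lambda>_. top_of_set {0..1}) {..<n}"

definition cube_boundary :: "nat \<Rightarrow> (nat \<Rightarrow> real) set" where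
  "cube_boundary n = {t \<in> topspace (cube n). \<exists>i<n. t i = 0 \<or> t i = 1}"

text \<open>
  Elements of the \<open>n\<close>-th homotopy group at \<open>a\<close> are homotopy classes, relative to the boundary, of
  maps from the \<open>n\<close>-cube that send the boundary to \<open>a\<close>; the neutral element is the class of the
  constant map.
\<close>

definition trivial_homotopy_group :: "nat \<Rightarrow> 'a topology \<Rightarrow> 'a \<Rightarrow> bool" where
  "trivial_homotopy_group n X a \<longleftrightarrow>
    (\<forall>f. continuous_map (cube n) X f \<and> (\<forall>t\<in>cube_boundary n. f t = a) \<longrightarrow>
      homotopic_with (\<lambda>h. \<forall>t\<in>cube_boundary n. h t = a) (cube n) X f (\<lambda>_. a))"

text \<open>The group \<open>\<pi>\<close> of a \<open>K(\<pi>,1)\<close> space is its fundamental group, on which nothing is required.\<close>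

definition K_pi_1_space :: "'a topology \<Rightarrow> bool" where
  "K_pi_1_space X \<longleftrightarrow> topspace X \<noteq> {} \<and> path_connected_space X \<and>
    (\<forall>n\<ge>2. \<forall>a\<in>topspace X. trivial_homotopy_group n X a)"

end

theory Submission
  imports Defs "HOL-Complex_Analysis.Riemann_Mapping"
begin

text \<open>
  In the chart \<open>z = 1\<close> the complement of the curve consists of the points \<open>(x, y)\<close> with \<open>y \<noteq> 0\<close>,
  \<open>y ^ m \<noteq> -1\<close> and \<open>x ^ m \<noteq> g y\<close>, where \<open>g y = - y ^ m / (y ^ m + 1)\<close> does not vanish. Projecting from
  \<open>(1 : 0 : 0)\<close> is \<open>(x, y) \<mapsto> y\<close>, and a local \<open>m\<close>-th root of \<open>g\<close> trivializes it.

  For asphericity, a map from a cube to an open subset of \<open>\<complex>\<close> is shown to factor through a disc by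
  Koebe's construction: iterated branched double coverings of the disc, each unbranched over the
  given domain, lift the map and make the preimage of the domain contain ever larger discs about
  \<open>0\<close>, while by the Schwarz-Pick lemma all lifts stay in one fixed smaller disc. Applied first to \<open>y\<close>
  and then to \<open>x / w y\<close> with \<open>w ^ m = g\<close>, this factors every map from a cube to the complement through
  a convex set, where it can be contracted along straight lines.
\<close>

section \<open>Koebe maps\<close>

text \<open>The classical argument passes through universal coverings and the long exact sequence of
  the fibration. Here maps from cubes are treated directly: a compact cube only sees a finite stage
  of Koebe's construction, so no limit covering has to be built. The obstacle is a circularity,
  since the disc that a stage \<open>P\<close> must carry into the domain has to contain the lift
  through that same \<open>P\<close>. It is broken by a bound on lifts that depends on the map alone
  and holds for every stage at once; the radius is fixed by this bound, and only then is
  \<open>P\<close> chosen. A second point is the base point. A contraction in the convex set fixes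
  the boundary of the cube only if the factored map is constant there. For this reason every
  factorization also records that connected sets on which the map is constant stay sets of
  constancy. The function \<open>g\<close> comes from solving the third factor of the equation for
  \<open>x ^ m\<close>. The line \<open>z = 0\<close> belongs to the curve, and hence a single chart
  suffices.\<close>

lemma Moebius_norm_identity:
  assumes "norm w < 1" "norm z < 1"
  shows "1 - (norm (Moebius_function 0 w z))\<^sup>2
           = (1 - (norm w)\<^sup>2) * (1 - (norm z)\<^sup>2) / (norm (1 - cnj w * z))\<^sup>2"
proof -
  have nz: "1 - cnj w * z \<noteq> 0"
    using norm_mult_less[of "cnj w" 1 z 1] assms by auto
  have eq: "(norm (1 - cnj w * z))\<^sup>2 - (norm (z - w))\<^sup>2 = (1 - (norm w)\<^sup>2) * (1 - (norm z)\<^sup>2)"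
    unfolding cmod_power2 by (simp add: algebra_simps power2_eq_square)
  have "1 - (norm (Moebius_function 0 w z))\<^sup>2
      = ((norm (1 - cnj w * z))\<^sup>2 - (norm (z - w))\<^sup>2) / (norm (1 - cnj w * z))\<^sup>2"
    using nz by (simp add: Moebius_function_simple norm_divide power_divide field_simps)
  then show ?thesis by (simp only: eq)
qed

lemma Moebius_eq_zero_iff:
  assumes "norm w < 1" "norm z < 1"
  shows "Moebius_function 0 w z = 0 \<longleftrightarrow> z = w"
proof -
  have "1 - cnj w * z \<noteq> 0"
    using norm_mult_less[of "cnj w" 1 z 1] assms by auto
  then show ?thesis by (simp add: Moebius_function_simple)
qed

lemma Moebius_has_field_derivative:
  assumes "1 - cnj w * z \<noteq> 0"
  shows "(Moebius_function 0 w has_field_derivative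
           (1 - cnj w * w) / (1 - cnj w * z)\<^sup>2) (at z)"
proof -
  have "((\<lambda>z. (z - w) / (1 - cnj w * z)) has_field_derivative
         (1 * (1 - cnj w * z) - (z - w) * (- cnj w)) / ((1 - cnj w * z) * (1 - cnj w * z))) (at z)"
    by (rule DERIV_divide) (use assms in \<open>auto intro!: derivative_eq_intros\<close>)
  moreover have eq: "1 * (1 - cnj w * z) - (z - w) * (- cnj w) = 1 - cnj w * w"
    by (simp add: algebra_simps)
  ultimately show ?thesis
    unfolding Moebius_function_simple[abs_def] power2_eq_square eq by (simp only:)
qed

text \<open>Rescaling the ball to the unit disc and moving \<open>\<sigma> z\<close> to 0 by a
  Moebius function reduces the claim to Schwarz's lemma on the disc of radius 1/2. What matters is
  uniformity: \<open>M'\<close> depends on \<open>M\<close> alone, not on \<sigma>, its centre or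
  the radius.\<close>

lemma Schwarz_Pick_half_ball:
  assumes "0 \<le> M" "M < 1"
  obtains M' where "M' < 1" "M \<le> M'"
    "\<And>\<sigma> z \<delta> \<zeta>. \<lbrakk>\<sigma> holomorphic_on ball z \<delta>; \<sigma> ` ball z \<delta> \<subseteq> ball 0 1; norm (\<sigma> z) \<le> M;
        \<delta> > 0; dist z \<zeta> \<le> \<delta> / 2\<rbrakk> \<Longrightarrow> norm (\<sigma> \<zeta>) \<le> M'"
proof -
  \<comment> \<open>The factor 3/16 is (1 - (1/2)^2) / 2^2: the moved value has norm at most 1/2,
    and the denominator in the Moebius identity has norm at most 2.\<close>
  define e where "e = 3 * (1 - M\<^sup>2) / 16"
  define M' where "M' = max M (sqrt (1 - e))"
  have M2: "M\<^sup>2 < 1" using assms by (simp add: power_less_one_iff abs_square_less_1)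
  then have e: "e > 0" by (simp add: e_def)

  show ?thesis
  proof (rule that[of M'])
    show "M' < 1" using assms e by (simp add: M'_def)
    show "M \<le> M'" by (simp add: M'_def)
    fix \<sigma> and z :: complex and \<delta> :: real and \<zeta>
    assume hol: "\<sigma> holomorphic_on ball z \<delta>" and im: "\<sigma> ` ball z \<delta> \<subseteq> ball 0 1"
      and le: "norm (\<sigma> z) \<le> M" and \<delta>: "\<delta> > 0" and \<zeta>: "dist z \<zeta> \<le> \<delta> / 2"
    define w where "w = \<sigma> z"
    have w: "norm w < 1" using le assms by (simp add: w_def)
    define g where "g u = Moebius_function 0 w (\<sigma> (z + of_real \<delta> * u))" for u
    have inb: "z + of_real \<delta> * u \<in> ball z \<delta>" if "norm u < 1" for u
      using that \<delta> by (simp add: dist_norm norm_mult)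
    have "(\<lambda>u. z + of_real \<delta> * u) ` ball 0 1 \<subseteq> ball z \<delta>"
      using inb by auto
    then have "(\<sigma> \<circ> (\<lambda>u. z + of_real \<delta> * u)) holomorphic_on ball 0 1"
      by (intro holomorphic_on_compose_gen[OF _ hol] holomorphic_intros) auto
    then have "(Moebius_function 0 w \<circ> (\<sigma> \<circ> (\<lambda>u. z + of_real \<delta> * u))) holomorphic_on ball 0 1"
      by (rule holomorphic_on_compose_gen[OF _ Moebius_function_holomorphic[OF w]])
         (use im inb in force)
    then have g_hol: "g holomorphic_on ball 0 1"
      by (simp add: g_def[abs_def] o_def)
    have g0: "g 0 = 0" by (simp add: g_def w_def Moebius_function_eq_zero)
    have s1: "norm (\<sigma> (z + of_real \<delta> * u)) < 1" if "norm u < 1" for u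
      using im inb[OF that] by (simp add: image_subset_iff)
    have g1: "norm (g u) < 1" if "norm u < 1" for u
      unfolding g_def by (rule Moebius_function_norm_lt_1[OF w s1[OF that]])
    define u where "u = (\<zeta> - z) / of_real \<delta>"
    have u: "norm u \<le> 1/2" 
      using \<zeta> \<delta> by (simp add: u_def norm_divide dist_norm norm_minus_commute field_simps)
    then have u1: "norm u < 1" by simp
    have "norm (g u) \<le> 1/2" using Schwarz_Lemma(1)[OF g_hol g0 g1 u1] u by simp
    moreover have \<zeta>u: "z + of_real \<delta> * u = \<zeta>" using \<delta> by (simp add: u_def)
    ultimately have v: "norm (g u) \<le> 1/2" by simp
    \<comment> \<open>Undoing the Moebius function expresses \<open>\<sigma> \<zeta>\<close> through
      \<open>g u\<close>, whose norm Schwarz's lemma controls.\<close>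
    have "\<sigma> \<zeta> = Moebius_function 0 (-w) (g u)"
      using Moebius_function_compose[of "-w" w "\<sigma> \<zeta>"] w s1[OF u1] by (simp add: g_def \<zeta>u)
    then have id: "1 - (norm (\<sigma> \<zeta>))\<^sup>2
        = (1 - (norm w)\<^sup>2) * (1 - (norm (g u))\<^sup>2) / (norm (1 + cnj w * g u))\<^sup>2"
      using Moebius_norm_identity[of "-w" "g u"] w g1[OF u1] by simp
    have "(norm w)\<^sup>2 \<le> M\<^sup>2" using le by (intro power_mono) (auto simp: w_def)
    moreover have "(norm (g u))\<^sup>2 \<le> (1/2)\<^sup>2" using v by (intro power_mono) auto
    ultimately have "(1 - M\<^sup>2) * (3/4) \<le> (1 - (norm w)\<^sup>2) * (1 - (norm (g u))\<^sup>2)"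
      using M2 by (intro mult_mono) (auto simp: power2_eq_square)
    moreover have "(norm (1 + cnj w * g u))\<^sup>2 \<le> 2\<^sup>2"
    proof (rule power_mono)
      have "norm (1 + cnj w * g u) \<le> 1 + norm w * norm (g u)"
        by (metis complex_mod_cnj norm_mult norm_one norm_triangle_ineq)
      also have "\<dots> \<le> 1 + 1 * 1" using w g1[OF u1] by (intro add_mono mult_mono) auto
      finally show "norm (1 + cnj w * g u) \<le> 2" by simp
    qed simp
    moreover have "norm (1 + cnj w * g u) > 0"
      using norm_mult_less[of "- cnj w" 1 "g u" 1] w g1[OF u1]
      by (metis add.inverse_inverse complex_mod_cnj less_irrefl mult_minus_left norm_minus_cancel
          norm_one mult_1 neg_eq_iff_add_eq_0 zero_less_norm_iff)
    ultimately have "(1 - M\<^sup>2) * (3/4) / 2\<^sup>2 \<le> 1 - (norm (\<sigma> \<zeta>))\<^sup>2"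
      unfolding id using M2 by (intro frac_le) auto
    then have "(norm (\<sigma> \<zeta>))\<^sup>2 \<le> 1 - e" unfolding e_def by (simp add: field_simps)
    then have "norm (\<sigma> \<zeta>) \<le> sqrt (1 - e)" by (rule real_le_rsqrt)
    then show "norm (\<sigma> \<zeta>) \<le> M'" by (simp add: M'_def)
  qed
qed

text \<open>The double covering of the disc that fixes \<open>0\<close> and is branched over \<open>- c\<^sup>2\<close>.\<close>

definition koebe :: "complex \<Rightarrow> complex \<Rightarrow> complex" where
  "koebe c z = Moebius_function 0 (c\<^sup>2) ((Moebius_function 0 (-c) z)\<^sup>2)"

text \<open>\<open>Moebius_koebe\<close> is the key relation: up to Moebius functions, lifting
  through \<open>koebe c\<close> means extracting a square root, which is possible away from the
  branch value -c^2. The derivative at 0 has norm 2|c| / (1 + |c|^2) < 1; this shrinking drives the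
  minimization of the derivative below.\<close>

lemma koebe_facts:
  assumes "norm c < 1"
  shows koebe_holomorphic: "koebe c holomorphic_on ball 0 1"
    and koebe_norm: "norm z < 1 \<Longrightarrow> norm (koebe c z) < 1"
    and koebe_zero: "koebe c 0 = 0"
    and Moebius_koebe: "norm z < 1 \<Longrightarrow>
           Moebius_function 0 (-(c\<^sup>2)) (koebe c z) = (Moebius_function 0 (-c) z)\<^sup>2"
    and koebe_lift: "norm s < 1 \<Longrightarrow> koebe c (Moebius_function 0 c s) = Moebius_function 0 (c\<^sup>2) (s\<^sup>2)"
    and koebe_deriv: "(koebe c has_field_derivative 2 * c / (1 + of_real (norm c)^2)) (at 0)"
proof -
  have c: "norm (-c) < 1" "norm (c\<^sup>2) < 1" "norm (-(c\<^sup>2)) < 1"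
    using assms by (auto simp: norm_power power_less_one_iff abs_square_less_1)
  have sq: "norm ((Moebius_function 0 (-c) z)\<^sup>2) < 1" if "norm z < 1" for z
    using Moebius_function_norm_lt_1[OF c(1) that]
    by (simp add: norm_power abs_square_less_1)
  have "Moebius_function 0 (c\<^sup>2) \<circ> (\<lambda>z. (Moebius_function 0 (-c) z)\<^sup>2) holomorphic_on ball 0 1"
    by (rule holomorphic_on_compose_gen[OF _ Moebius_function_holomorphic[OF c(2)]])
       (use sq Moebius_function_holomorphic[OF c(1)] in \<open>auto intro!: holomorphic_intros\<close>)
  then show "koebe c holomorphic_on ball 0 1"
    by (simp add: koebe_def[abs_def] o_def)
  show "norm (koebe c z) < 1" if "norm z < 1" for z
    unfolding koebe_def by (rule Moebius_function_norm_lt_1[OF c(2) sq[OF that]])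
  show "koebe c 0 = 0"
    by (simp add: koebe_def Moebius_function_of_zero Moebius_function_eq_zero)
  show "Moebius_function 0 (-(c\<^sup>2)) (koebe c z) = (Moebius_function 0 (-c) z)\<^sup>2" if "norm z < 1" for z
    unfolding koebe_def by (rule Moebius_function_compose) (use c sq[OF that] in auto)
  show "koebe c (Moebius_function 0 c s) = Moebius_function 0 (c\<^sup>2) (s\<^sup>2)" if "norm s < 1" for s
    unfolding koebe_def using Moebius_function_compose[of "-c" c s] c that by simp
  have "norm c ^ 2 < 1" "norm c ^ 4 < 1"
    using assms power_less_one_iff[of "norm c"] by auto
  then have "1 - norm c ^ 2 \<noteq> 0" "1 - norm c ^ 4 \<noteq> 0" "1 + norm c ^ 2 \<noteq> 0"
    by (auto simp: add_nonneg_eq_0_iff)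
  then have nz: "complex_of_real (1 - norm c ^ 2) \<noteq> 0" "complex_of_real (1 - norm c ^ 4) \<noteq> 0"
    "complex_of_real (1 + norm c ^ 2) \<noteq> 0"
    unfolding of_real_eq_0_iff by blast+
  note n = nz[unfolded of_real_diff of_real_add of_real_power of_real_1]
  have cc: "cnj c * c = of_real (norm c)^2"
    using complex_norm_square[of c] by (simp add: mult.commute)
  have cc2: "cnj c ^ 2 * c ^ 2 = of_real (norm c)^4"
    unfolding power_mult_distrib[symmetric] cc by simp
  have d1: "(Moebius_function 0 (-c) has_field_derivative 1 - of_real (norm c)^2) (at 0)"
    using Moebius_has_field_derivative[of "-c" 0] by (simp add: cc)
  have d2: "(Moebius_function 0 (c\<^sup>2) has_field_derivative 1 / (1 - of_real (norm c)^4)) (at (c\<^sup>2))"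
  proof -
    have e: "1 - cnj (c\<^sup>2) * c\<^sup>2 = 1 - of_real (norm c)^4" using cc2 by simp
    have "(1 - complex_of_real (norm c)^4) / (1 - of_real (norm c)^4)\<^sup>2 = 1 / (1 - of_real (norm c)^4)"
      using n(2) by (simp add: power2_eq_square)
    with Moebius_has_field_derivative[of "c\<^sup>2" "c\<^sup>2", unfolded e, OF n(2)] show ?thesis
      by (simp only:)
  qed
  have m0: "Moebius_function 0 (-c) 0 = c" by (simp add: Moebius_function_of_zero)
  have "((\<lambda>z. (Moebius_function 0 (-c) z)\<^sup>2) has_field_derivative
          2 * c * (1 - of_real (norm c)^2)) (at 0)"
    by (rule derivative_eq_intros d1 refl)+ (simp add: m0)
  from DERIV_chain2[OF _ this, of "Moebius_function 0 (c\<^sup>2)", unfolded m0, OF d2]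
  have "(koebe c has_field_derivative
         1 / (1 - of_real (norm c)^4) * (2 * c * (1 - of_real (norm c)^2))) (at 0)"
    by (simp add: koebe_def[abs_def])
  also have "1 / (1 - of_real (norm c)^4) * (2 * c * (1 - of_real (norm c)^2))
      = 2 * c / (1 + complex_of_real (norm c)^2)"
  proof -
    have "1 - complex_of_real (norm c)^4 = (1 - of_real (norm c)^2) * (1 + of_real (norm c)^2)"
      by (simp add: algebra_simps power2_eq_square power4_eq_xxxx)
    then show ?thesis using n by simp
  qed
  finally show "(koebe c has_field_derivative 2 * c / (1 + of_real (norm c)^2)) (at 0)" .
qed

section \<open>Iterated Koebe coverings: lifting and uniqueness of lifts\<close>

text \<open>The new double covering is composed on the inside. Its branch value -c^2 must be sent
  outside \<open>D\<close> by \<open>P\<close>, so that a lift through \<open>P\<close> of a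
  function into \<open>D\<close> never meets it.\<close>

inductive_set koebe_maps :: "complex set \<Rightarrow> (complex \<Rightarrow> complex) set" for D where
  koebe_id: "(\<lambda>z. z) \<in> koebe_maps D"
| koebe_step: "\<lbrakk>P \<in> koebe_maps D; norm c < 1; P (-(c\<^sup>2)) \<notin> D\<rbrakk> \<Longrightarrow> (\<lambda>z. P (koebe c z)) \<in> koebe_maps D"

lemma koebe_maps_facts:
  assumes "P \<in> koebe_maps D"
  shows koebe_maps_holomorphic: "P holomorphic_on ball 0 1"
    and koebe_maps_zero: "P 0 = 0"
proof -
  have "P holomorphic_on ball 0 1 \<and> P 0 = 0"
    using assms
  proof induction
    case koebe_id
    show ?case by (simp add: holomorphic_intros)
  next
    case (koebe_step P c)
    have "P \<circ> koebe c holomorphic_on ball 0 1"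
      by (rule holomorphic_on_compose_gen[of _ _ _ "ball 0 1"])
         (use koebe_step koebe_holomorphic koebe_norm in auto)
    then show ?case
      using koebe_step koebe_norm koebe_zero by (auto simp: o_def)
  qed
  then show "P holomorphic_on ball 0 1" "P 0 = 0" by auto
qed

text \<open>The class \<open>\<A>\<close> of functions stands for the continuous or the holomorphic ones.\<close>

lemma koebe_maps_lift:
  fixes f :: "'a \<Rightarrow> complex"
  assumes P: "P \<in> koebe_maps D" and D: "D \<subseteq> ball 0 1"
    and Moebius: "\<And>g w. \<lbrakk>\<A> g; g ` S \<subseteq> ball 0 1; norm w < 1\<rbrakk> \<Longrightarrow> \<A> (\<lambda>x. Moebius_function 0 w (g x))"
    and root: "\<And>g. \<lbrakk>\<A> g; \<forall>x\<in>S. g x \<noteq> 0\<rbrakk> \<Longrightarrow> \<exists>s. \<A> s \<and> (\<forall>x\<in>S. g x = (s x)\<^sup>2)"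
    and minus: "\<And>g. \<A> g \<Longrightarrow> \<A> (\<lambda>x. - g x)"
    and f: "\<A> f" "f ` S \<subseteq> D" and x: "x \<in> S" and w: "norm w < 1" "P w = f x"
  shows "\<exists>F. \<A> F \<and> F ` S \<subseteq> ball 0 1 \<and> (\<forall>y\<in>S. P (F y) = f y) \<and> F x = w"
  using P w
proof (induction arbitrary: w)
  case koebe_id
  then show ?case using f D by auto
next
  case (koebe_step P c)
  note c = \<open>norm c < 1\<close>
  have c2: "norm (-(c\<^sup>2)) < 1" "norm (c\<^sup>2) < 1" using c by (auto simp: norm_power power_less_one_iff abs_square_less_1)
  have "norm (koebe c w) < 1" "P (koebe c w) = f x"
    using koebe_step c koebe_norm by auto
  from koebe_step.IH[OF this] obtain F where F: "\<A> F" "F ` S \<subseteq> ball 0 1"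
    "\<And>y. y \<in> S \<Longrightarrow> P (F y) = f y" "F x = koebe c w" by blast
  \<comment> \<open>The branch value of \<open>koebe c\<close> is moved to 0, so \<open>h\<close>
    has no zeros on \<open>S\<close> and a square root of it is a lift through
    \<open>koebe c\<close> in disguise.\<close>
  define h where "h y = Moebius_function 0 (-(c\<^sup>2)) (F y)" for y
  have h: "\<A> h" unfolding h_def using Moebius F c2 by blast
  have F1: "norm (F y) < 1" if "y \<in> S" for y using F(2) that by auto
  have "h y \<noteq> 0" if "y \<in> S" for y
  proof
    assume "h y = 0"
    then have "F y = -(c\<^sup>2)" using Moebius_eq_zero_iff[OF c2(1) F1[OF that]] by (simp add: h_def)
    then have "f y \<notin> D" using F(3)[OF that] koebe_step by simp
    then show False using f that by auto
  qed
  then obtain s where s: "\<A> s" "\<And>y. y \<in> S \<Longrightarrow> h y = (s y)\<^sup>2"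
    using root[OF h] by blast
  have hx: "h x = (Moebius_function 0 (-c) w)\<^sup>2"
    unfolding h_def F(4) using Moebius_koebe[OF c] koebe_step by blast
  \<comment> \<open>Of the two square roots, the one with the prescribed value at \<open>x\<close>
    is taken. Both agree up to sign there, because \<open>w\<close> lies over the value of
    \<open>F\<close> at \<open>x\<close>.\<close>
  obtain t where t: "\<A> t" "\<And>y. y \<in> S \<Longrightarrow> h y = (t y)\<^sup>2" "t x = Moebius_function 0 (-c) w"
  proof (cases "s x = Moebius_function 0 (-c) w")
    case True then show ?thesis using that s by blast
  next
    case False
    then have "- s x = Moebius_function 0 (-c) w"
      using s(2)[OF x] hx by (simp add: power2_eq_iff)
    then show ?thesis using that[of "\<lambda>x. - s x"] s minus[OF s(1)] by simp
  qed
  have t1: "norm (t y) < 1" if "y \<in> S" for y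
  proof -
    have "norm ((t y)\<^sup>2) < 1"
      using Moebius_function_norm_lt_1[OF c2(1) F1[OF that], of 0] t(2)[OF that] by (simp only: h_def)
    then show ?thesis by (simp add: norm_power abs_square_less_1)
  qed
  show ?case
  proof (intro exI[of _ "\<lambda>y. Moebius_function 0 c (t y)"] conjI ballI)
    show "\<A> (\<lambda>y. Moebius_function 0 c (t y))"
      using Moebius[OF t(1) _ c] t1 by (simp add: image_subset_iff)
    show "(\<lambda>y. Moebius_function 0 c (t y)) ` S \<subseteq> ball 0 1"
      using Moebius_function_norm_lt_1[OF c t1] by auto
    show "P (koebe c (Moebius_function 0 c (t y))) = f y" if "y \<in> S" for y
    proof -
      have "koebe c (Moebius_function 0 c (t y)) = Moebius_function 0 (c\<^sup>2) (h y)"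
        using koebe_lift[OF c t1[OF that]] t(2)[OF that] by simp
      also have "\<dots> = F y"
        unfolding h_def by (rule Moebius_function_compose) (use c2 F1[OF that] in auto)
      finally show ?thesis using F(3)[OF that] by simp
    qed
    show "Moebius_function 0 c (t x) = w"
      unfolding t(3) by (rule Moebius_function_compose) (use c koebe_step in auto)
  qed
qed

lemma koebe_maps_lift_continuous:
  fixes f :: "'a::real_normed_vector \<Rightarrow> complex"
  assumes "P \<in> koebe_maps D" "D \<subseteq> ball 0 1" "convex S" "continuous_on S f" "f ` S \<subseteq> D"
    "x \<in> S" "norm w < 1" "P w = f x"
  obtains F where "continuous_on S F" "F ` S \<subseteq> ball 0 1" "\<And>y. y \<in> S \<Longrightarrow> P (F y) = f y" "F x = w"
proof -
  have "\<exists>F. continuous_on S F \<and> F ` S \<subseteq> ball 0 1 \<and> (\<forall>y\<in>S. P (F y) = f y) \<and> F x = w"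
  proof (rule koebe_maps_lift[OF assms(1,2)])
    show "continuous_on S (\<lambda>x. Moebius_function 0 w (g x))"
      if "continuous_on S g" "g ` S \<subseteq> ball 0 1" "norm w < 1" for g w
      using continuous_on_compose2[OF holomorphic_on_imp_continuous_on[OF Moebius_function_holomorphic]] that
      by blast
    show "\<exists>s. continuous_on S s \<and> (\<forall>x\<in>S. g x = (s x)\<^sup>2)"
      if "continuous_on S g" "\<forall>x\<in>S. g x \<noteq> 0" for g :: "'a \<Rightarrow> complex"
      using continuous_sqrt_on_contractible[OF that(1) convex_imp_contractible[OF \<open>convex S\<close>]] that(2) by metis
  qed (use assms in \<open>auto intro: continuous_intros\<close>)
  then show ?thesis using that by blast
qed

text \<open>The identity of the ball is lifted within the class of holomorphic functions. The result
  is an inverse branch of \<open>P\<close> on the whole of any ball inside \<open>D\<close>, to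
  which Schwarz's lemma applies.\<close>

lemma koebe_maps_section:
  assumes "P \<in> koebe_maps D" "D \<subseteq> ball 0 1" "ball z \<delta> \<subseteq> D" "\<delta> > 0" "norm w < 1" "P w = z"
  obtains \<sigma> where "\<sigma> holomorphic_on ball z \<delta>" "\<sigma> ` ball z \<delta> \<subseteq> ball 0 1"
    "\<And>y. y \<in> ball z \<delta> \<Longrightarrow> P (\<sigma> y) = y" "\<sigma> z = w"
proof -
  have "\<exists>\<sigma>. \<sigma> holomorphic_on ball z \<delta> \<and> \<sigma> ` ball z \<delta> \<subseteq> ball 0 1 \<and> (\<forall>y\<in>ball z \<delta>. P (\<sigma> y) = y) \<and> \<sigma> z = w"
  proof (rule koebe_maps_lift[OF assms(1,2)])
    show "(\<lambda>x. Moebius_function 0 w (g x)) holomorphic_on ball z \<delta>"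
      if "g holomorphic_on ball z \<delta>" "g ` ball z \<delta> \<subseteq> ball 0 1" "norm w < 1" for g w
      using holomorphic_on_compose_gen[OF that(1) Moebius_function_holomorphic[OF that(3)] that(2)]
      by (simp add: o_def)
    show "\<exists>s. s holomorphic_on ball z \<delta> \<and> (\<forall>x\<in>ball z \<delta>. g x = (s x)\<^sup>2)"
      if "g holomorphic_on ball z \<delta>" "\<forall>x\<in>ball z \<delta>. g x \<noteq> 0" for g
      using contractible_imp_holomorphic_sqrt[OF that(1) convex_imp_contractible[OF convex_ball]] that(2) by metis
  qed (use assms in \<open>auto intro: holomorphic_intros\<close>)
  then show ?thesis using that by blast
qed

text \<open>Two lifts through one double covering correspond to two square roots of the same
  nonvanishing function. Their quotient is continuous with values in {1, -1}, hence constant on a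
  connected set. Taking \<open>G\<close> constant shows that a lift of a constant function is
  constant.\<close>

lemma koebe_maps_lift_unique:
  fixes F G :: "'a::topological_space \<Rightarrow> complex"
  assumes "P \<in> koebe_maps D" "connected S" "x \<in> S" "y \<in> S"
    and "continuous_on S F" "F ` S \<subseteq> ball 0 1" "continuous_on S G" "G ` S \<subseteq> ball 0 1"
    and "\<And>y. y \<in> S \<Longrightarrow> P (F y) = P (G y)" "\<And>y. y \<in> S \<Longrightarrow> P (F y) \<in> D" "F x = G x"
  shows "F y = G y"
  using assms(1,4-)
proof (induction arbitrary: F G y)
  case koebe_id
  then show ?case by simp
next
  case (koebe_step P c)
  note c = \<open>norm c < 1\<close>
  then have c': "norm (-c) < 1" by simp
  have c2: "norm (c\<^sup>2) < 1" using c by (auto simp: norm_power power_less_one_iff abs_square_less_1)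
  have cont: "continuous_on S (\<lambda>x. \<phi> (H x))" if "\<phi> holomorphic_on ball 0 1" "continuous_on S H" "H ` S \<subseteq> ball 0 1" for \<phi> H
    by (rule continuous_on_compose2[OF holomorphic_on_imp_continuous_on[OF that(1)] that(2,3)])
  note kcont = cont[OF koebe_holomorphic[OF c]]
  have ball: "norm (F z) < 1" "norm (G z) < 1" if "z \<in> S" for z
    using koebe_step that by auto
  have eq: "koebe c (F z) = koebe c (G z)" if "z \<in> S" for z
    by (rule koebe_step.IH[OF that]) (use koebe_step koebe_norm[OF c] kcont ball in auto)
  define s where "s H z = Moebius_function 0 (-c) (H z)" for H :: "'a \<Rightarrow> complex" and z
  have sF: "continuous_on S (s F)" and sG: "continuous_on S (s G)"
    unfolding s_def using cont[OF Moebius_function_holomorphic[OF c']] koebe_step by auto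
  have sq: "(s F z)\<^sup>2 = (s G z)\<^sup>2" if "z \<in> S" for z
    unfolding s_def using eq[OF that] Moebius_koebe[OF c ball(1)[OF that]] Moebius_koebe[OF c ball(2)[OF that]] by simp
  \<comment> \<open>A zero would put \<open>koebe c (G z)\<close> at the branch value, which
    \<open>P\<close> sends outside \<open>D\<close>.\<close>
  have nz: "s G z \<noteq> 0" if "z \<in> S" for z
  proof
    assume "s G z = 0"
    then have "koebe c (G z) = -(c\<^sup>2)" by (simp add: koebe_def s_def Moebius_function_of_zero)
    then show False using koebe_step.hyps(3) koebe_step.prems(7)[OF that] eq[OF that] by simp
  qed
  have conn: "connected ((\<lambda>z. s F z / s G z) ` S)"
    by (intro connected_continuous_image continuous_intros sF sG assms(2)) (use nz in auto)
  moreover have sub: "(\<lambda>z. s F z / s G z) ` S \<subseteq> {1, -1}"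
    using sq nz by (fastforce simp: power2_eq_iff)
  then have "finite ((\<lambda>z. s F z / s G z) ` S)" by (rule finite_subset) simp
  ultimately obtain k where k: "(\<lambda>z. s F z / s G z) ` S \<subseteq> {k}"
    unfolding connected_finite_iff_sing[OF conn] by auto
  have "s F z / s G z = k" if "z \<in> S" for z using k that by auto
  then have "s F y / s G y = s F x / s G x" using \<open>y \<in> S\<close> assms(3) by simp
  also have "\<dots> = 1" using nz[OF assms(3)] koebe_step.prems by (simp add: s_def)
  finally have "s F y = s G y" using nz \<open>y \<in> S\<close> by auto
  then have "Moebius_function 0 c (s F y) = Moebius_function 0 c (s G y)" by simp
  then show ?case
    unfolding s_def using Moebius_function_compose[of c "-c"] c ball \<open>y \<in> S\<close> by simp
qed

text \<open>The inverse branch on \<open>ball 0 r\<close>, rescaled to the unit disc, has derivative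
  of norm at most 1 at 0 by Schwarz's lemma, while its composition with \<open>P\<close> is
  multiplication by \<open>r\<close>. The infimum of the derivatives over all Koebe maps is
  therefore positive.\<close>

lemma koebe_maps_deriv_lower_bound:
  assumes "P \<in> koebe_maps D" "D \<subseteq> ball 0 1" "ball 0 r \<subseteq> D" "r > 0"
  shows "r \<le> norm (deriv P 0)"
proof -
  obtain \<sigma> where \<sigma>: "\<sigma> holomorphic_on ball 0 r" "\<sigma> ` ball 0 r \<subseteq> ball 0 1"
    "\<And>y. y \<in> ball 0 r \<Longrightarrow> P (\<sigma> y) = y" "\<sigma> 0 = 0"
    using koebe_maps_section[OF assms, of 0] koebe_maps_zero[OF assms(1)] by auto
  define g where "g u = \<sigma> (of_real r * u)" for u
  have inb: "of_real r * u \<in> ball 0 r" if "norm u < 1" for u :: complex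
    using that assms by (simp add: norm_mult)
  have "\<sigma> \<circ> (\<lambda>u. of_real r * u) holomorphic_on ball 0 1"
    by (rule holomorphic_on_compose_gen[OF _ \<sigma>(1)]) (use inb in \<open>auto intro!: holomorphic_intros\<close>)
  then have hol: "g holomorphic_on ball 0 1" by (simp add: g_def[abs_def] o_def)
  have g0: "g 0 = 0" by (simp add: g_def \<sigma>)
  have g1: "norm (g u) < 1" if "norm u < 1" for u
    using \<sigma>(2) inb[OF that] by (force simp: g_def)
  have dg: "norm (deriv g 0) \<le> 1" using Schwarz_Lemma(2)[OF hol g0 g1, of 0] by simp
  have "(g has_field_derivative deriv g 0) (at 0)"
    using hol by (auto intro: holomorphic_derivI)
  moreover have "(P has_field_derivative deriv P 0) (at (g 0))"
    using koebe_maps_holomorphic[OF assms(1)] by (auto simp: g0 intro: holomorphic_derivI)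
  ultimately have "((\<lambda>u. P (g u)) has_field_derivative deriv P 0 * deriv g 0) (at 0)"
    by (intro DERIV_chain2)
  moreover have "((\<lambda>u. P (g u)) has_field_derivative of_real r) (at 0)"
  proof (rule has_field_derivative_transform_within_open[of "\<lambda>u. of_real r * u" _ _ "ball 0 1"])
    show "((*) (complex_of_real r) has_field_derivative complex_of_real r) (at 0)"
      by (auto intro!: derivative_eq_intros)
  qed (use \<sigma>(3) inb in \<open>auto simp: g_def\<close>)
  ultimately have "deriv P 0 * deriv g 0 = of_real r" by (rule DERIV_unique)
  then have "r = norm (deriv P 0) * norm (deriv g 0)"
    using assms(4) by (metis norm_mult norm_of_real abs_of_pos)
  also have "\<dots> \<le> norm (deriv P 0) * 1" using dg by (intro mult_left_mono) auto
  finally show ?thesis by simp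
qed

section \<open>Uniform bounds on lifts and factorization through a disc\<close>

lemma koebe_maps_lift_bounded:
  fixes f :: "'a::real_normed_vector \<Rightarrow> complex"
  assumes K: "compact K" "convex K" "x0 \<in> K" and D: "open D" "D \<subseteq> ball 0 1"
    and f: "continuous_on K f" "f ` K \<subseteq> D"
  obtains M where "0 \<le> M" "M < 1"
    "\<And>P F x. \<lbrakk>P \<in> koebe_maps D; continuous_on K F; F ` K \<subseteq> ball 0 1;
       \<And>y. y \<in> K \<Longrightarrow> P (F y) = f y; F x0 = 0; x \<in> K\<rbrakk> \<Longrightarrow> norm (F x) \<le> M"
proof -
  have "compact (f ` K)" by (rule compact_continuous_image[OF f(1) K(1)])
  then obtain \<delta> where \<delta>: "\<delta> > 0" "(\<Union>z\<in>f ` K. ball z \<delta>) \<subseteq> D"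
    by (rule compact_subset_open_imp_ball_epsilon_subset[OF _ D(1) f(2)])
  have "uniformly_continuous_on K f"
    by (rule compact_uniformly_continuous[OF f(1) K(1)])
  then obtain \<eta> where \<eta>: "\<eta> > 0"
    "\<And>x y. \<lbrakk>x \<in> K; y \<in> K; dist y x < \<eta>\<rbrakk> \<Longrightarrow> dist (f y) (f x) < \<delta> / 2"
    unfolding uniformly_continuous_on_def using \<delta>(1) by (metis half_gt_zero)
  \<comment> \<open>All pairs are collected so that the induction below gives a single bound for
    every Koebe map and lift.\<close>
  define lifts where "lifts = {(P, F). P \<in> koebe_maps D \<and> continuous_on K F \<and> F ` K \<subseteq> ball 0 1 \<and>
       (\<forall>y\<in>K. P (F y) = f y) \<and> F x0 = 0}"
  have "\<exists>M. 0 \<le> M \<and> M < 1 \<and> (\<forall>(P, F)\<in>lifts. \<forall>x\<in>K. dist x0 x \<le> real n * (\<eta> / 2) \<longrightarrow> norm (F x) \<le> M)" for n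
  proof (induction n)
    case 0
    show ?case by (rule exI[of _ 0]) (auto simp: lifts_def)
  next
    case (Suc n)
    then obtain M where M: "0 \<le> M" "M < 1"
      "\<And>P F x. \<lbrakk>(P, F) \<in> lifts; x \<in> K; dist x0 x \<le> real n * (\<eta> / 2)\<rbrakk> \<Longrightarrow> norm (F x) \<le> M"
      by blast
    obtain M' where M': "M' < 1" "M \<le> M'"
      "\<And>\<sigma> z \<delta> \<zeta>. \<lbrakk>\<sigma> holomorphic_on ball z \<delta>; \<sigma> ` ball z \<delta> \<subseteq> ball 0 1; norm (\<sigma> z) \<le> M;
        \<delta> > 0; dist z \<zeta> \<le> \<delta> / 2\<rbrakk> \<Longrightarrow> norm (\<sigma> \<zeta>) \<le> M'"
      using Schwarz_Pick_half_ball[OF M(1,2)] by blast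
    have "norm (F x) \<le> M'"
      if L: "(P, F) \<in> lifts" and x: "x \<in> K" "dist x0 x \<le> real (Suc n) * (\<eta> / 2)" for P F x
    proof -
      have F: "P \<in> koebe_maps D" "continuous_on K F" "F ` K \<subseteq> ball 0 1"
        "\<And>y. y \<in> K \<Longrightarrow> P (F y) = f y" "F x0 = 0"
        using L by (auto simp: lifts_def)
      \<comment> \<open>With this ratio \<open>y\<close> lies within n steps of length \<eta>/2 from
        \<open>x0\<close>, where the induction hypothesis applies, and within one such step of
        \<open>x\<close>.\<close>
      define t where "t = real n / real (Suc n)"
      have t: "0 \<le> t" "t \<le> 1" by (auto simp: t_def)
      define y where "y = (1 - t) *\<^sub>R x0 + t *\<^sub>R x"
      have y: "y \<in> K" unfolding y_def using K(2,3) x(1) t by (intro convexD) auto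
      have yx0: "x0 - y = t *\<^sub>R (x0 - x)" and yx: "y - x = (1 - t) *\<^sub>R (x0 - x)"
        by (simp_all add: y_def algebra_simps)
      have "dist x0 y = t * dist x0 x" using t by (simp add: dist_norm yx0)
      also have "\<dots> \<le> t * (real (Suc n) * (\<eta> / 2))" using x t by (intro mult_left_mono) auto
      also have "\<dots> = real n * (\<eta> / 2)" by (simp add: t_def)
      finally have Fy: "norm (F y) \<le> M" by (rule M(3)[OF L y])
      have "dist y x = (1 - t) * dist x0 x" using t by (simp add: dist_norm yx)
      also have "\<dots> \<le> (1 - t) * (real (Suc n) * (\<eta> / 2))" using x t by (intro mult_left_mono) auto
      also have "\<dots> = \<eta> / 2" by (simp add: t_def field_simps)
      finally have yx: "dist y x < \<eta>" using \<eta>(1) by simp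
      have ball: "ball (f y) \<delta> \<subseteq> D" using \<delta>(2) y by auto
      have Fy1: "norm (F y) < 1" using Fy M(2) by simp
      obtain \<sigma> where \<sigma>: "\<sigma> holomorphic_on ball (f y) \<delta>" "\<sigma> ` ball (f y) \<delta> \<subseteq> ball 0 1"
        "\<And>z. z \<in> ball (f y) \<delta> \<Longrightarrow> P (\<sigma> z) = z" "\<sigma> (f y) = F y"
        using koebe_maps_section[OF F(1) D(2) ball \<delta>(1) Fy1 F(4)[OF y]] by blast
      \<comment> \<open>A connected piece of \<open>K\<close> containing \<open>x\<close> and
        \<open>y\<close> that \<open>f\<close> maps into the ball on which \<sigma> is defined; on
        it \<open>F\<close> and the composition of \<sigma> with \<open>f\<close> are lifts that
        agree at \<open>y\<close>.\<close>
      define S where "S = K \<inter> ball y \<eta>"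
      have S: "convex S" "S \<subseteq> K" "x \<in> S" "y \<in> S"
        using K(2) x y yx \<eta>(1) by (auto simp: S_def convex_Int)
      have fS: "f z \<in> ball (f y) \<delta>" if "z \<in> S" for z
        using \<eta>(2)[of z y] that y \<delta>(1) by (auto simp: S_def dist_commute)
      have "\<sigma> (f x) = F x"
      proof (rule koebe_maps_lift_unique[OF F(1) convex_connected[OF S(1)] S(4,3), symmetric])
        show "continuous_on S (\<lambda>z. \<sigma> (f z))"
          by (rule continuous_on_compose2[OF holomorphic_on_imp_continuous_on[OF \<sigma>(1)]])
             (use f S fS in \<open>auto intro: continuous_on_subset\<close>)
        show "continuous_on S F" using F S continuous_on_subset by blast
        show "P (F z) = P (\<sigma> (f z))" if "z \<in> S" for z
          using \<sigma>(3)[OF fS[OF that]] F(4) S that by auto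
        show "P (F z) \<in> D" if "z \<in> S" for z using F(4) f S that by auto
      qed (use F S fS \<sigma> in auto)
      moreover have "norm (\<sigma> (f x)) \<le> M'"
        using \<eta>(2)[OF x(1) y yx] Fy \<sigma>(4) by (intro M'(3)[OF \<sigma>(1,2) _ \<delta>(1)]) auto
      ultimately show ?thesis by simp
    qed
    then show ?case using M' M(1) by (intro exI[of _ M']) auto
  qed
  note bound = this
  obtain B where B: "\<And>x. x \<in> K \<Longrightarrow> dist x0 x \<le> B"
    using compact_imp_bounded[OF K(1)] bounded_any_center[of K x0] by auto
  obtain n where n: "B / (\<eta> / 2) \<le> real n" using real_arch_simple by blast
  have "dist x0 x \<le> real n * (\<eta> / 2)" if "x \<in> K" for x
    using B[OF that] n \<eta>(1) by (simp add: field_simps)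
  note reach = this
  obtain M where M: "0 \<le> M" "M < 1"
    "\<forall>(P, F)\<in>lifts. \<forall>x\<in>K. dist x0 x \<le> real n * (\<eta> / 2) \<longrightarrow> norm (F x) \<le> M"
    using bound[of n] by blast
  show ?thesis
  proof (rule that[OF M(1,2)])
    fix P F x
    assume "P \<in> koebe_maps D" "continuous_on K F" "F ` K \<subseteq> ball 0 1"
      "\<And>y. y \<in> K \<Longrightarrow> P (F y) = f y" "F x0 = 0" and x: "x \<in> K"
    then have "(P, F) \<in> lifts" by (simp add: lifts_def)
    then show "norm (F x) \<le> M" using M(3) reach[OF x] x by blast
  qed
qed

text \<open>The expression is the norm of the derivative of \<open>koebe c\<close> at 0 as a
  function of |c|; monotonicity bounds the shrinking factor for all missing points in a given
  disc.\<close>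

lemma two_div_one_plus_square_mono:
  fixes s t :: real
  assumes "0 \<le> s" "s \<le> t" "t \<le> 1"
  shows "2 * s / (1 + s\<^sup>2) \<le> 2 * t / (1 + t\<^sup>2)"
proof -
  have "0 \<le> (t - s) * (1 - s * t)"
    using assms mult_le_one[of s t] by (intro mult_nonneg_nonneg) auto
  then have "2 * s * (1 + t\<^sup>2) \<le> 2 * t * (1 + s\<^sup>2)"
    by (simp add: algebra_simps power2_eq_square)
  then show ?thesis
    by (simp add: divide_simps add_pos_nonneg)
qed

text \<open>
  If \<open>P\<close> almost minimizes \<open>\<bar>P'(0)\<bar>\<close> over the Koebe maps, then the part of the disc that \<open>P\<close> sends
  into \<open>D\<close> contains a large ball, since a missing point near \<open>0\<close> would allow a step that shrinks
  the derivative further.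
\<close>

lemma koebe_maps_exhaust:
  assumes D: "open D" "D \<subseteq> ball 0 1" "0 \<in> D" and M: "0 \<le> M" "M < 1"
  obtains P where "P \<in> koebe_maps D" "P ` ball 0 M \<subseteq> D"
proof -
  obtain r where r: "r > 0" "ball 0 r \<subseteq> D" using D openE by blast
  define \<Phi> where "\<Phi> = (\<lambda>P. norm (deriv P 0)) ` koebe_maps D"
  have ne: "\<Phi> \<noteq> {}" using koebe_id by (auto simp: \<Phi>_def)
  have lb: "r \<le> x" if "x \<in> \<Phi>" for x
    using that koebe_maps_deriv_lower_bound[OF _ D(2) r(2,1)] by (auto simp: \<Phi>_def)
  define \<beta> where "\<beta> = Inf \<Phi>"
  have \<beta>: "\<beta> > 0" using cInf_greatest[OF ne lb] r by (simp add: \<beta>_def)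
  have \<beta>_le: "\<beta> \<le> x" if "x \<in> \<Phi>" for x
    unfolding \<beta>_def by (rule cInf_lower[OF that]) (use lb in \<open>auto simp: bdd_below_def\<close>)
  \<comment> \<open>The shrinking factor for |c| = sqrt M, the worst case for a missing point of
    norm below \<open>M\<close>. Since it is less than 1, a derivative close enough to the positive
    infimum would be pushed below that infimum.\<close>
  define \<kappa> where "\<kappa> = 2 * sqrt M / (1 + M)"
  have "0 < (1 - sqrt M)\<^sup>2" using M by simp
  then have \<kappa>1: "\<kappa> < 1" using M by (simp add: \<kappa>_def power2_diff)
  have \<kappa>0: "\<kappa> \<ge> 0" using M by (simp add: \<kappa>_def)
  obtain P where P: "P \<in> koebe_maps D" "norm (deriv P 0) * \<kappa> < \<beta>"
  proof (cases "\<kappa> = 0")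
    case True
    then show ?thesis using that[OF koebe_id] \<beta> by simp
  next
    case False
    then have "\<kappa> > 0" using \<kappa>0 by simp
    then have "\<beta> < \<beta> / \<kappa>" using \<beta> \<kappa>1 by (simp add: field_simps)
    then obtain x where "x \<in> \<Phi>" "x < \<beta> / \<kappa>"
      unfolding \<beta>_def using cInf_lessD[OF ne] by blast
    then show ?thesis using that \<open>\<kappa> > 0\<close> by (auto simp: \<Phi>_def field_simps)
  qed
  have "P a \<in> D" if a: "norm a < M" for a
  proof (rule ccontr)
    assume "P a \<notin> D"
    \<comment> \<open>This choice makes the missing point \<open>a\<close> the branch value -c^2 of
      the next double covering.\<close>
    define c where "c = csqrt (- a)"
    have ca: "a = -(c\<^sup>2)" by (simp add: c_def)
    have "(norm c)\<^sup>2 = norm a" by (simp add: ca norm_power)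
    then have nc: "norm c = sqrt (norm a)" by (metis norm_ge_zero real_sqrt_unique)
    have "norm a < 1" using a M by simp
    then have c: "norm c < 1" by (simp add: nc)
    have "P (-(c\<^sup>2)) \<notin> D" using \<open>P a \<notin> D\<close> ca by simp
    then have Q: "(\<lambda>z. P (koebe c z)) \<in> koebe_maps D" by (rule koebe_step[OF P(1) c])
    have "(P has_field_derivative deriv P 0) (at (koebe c 0))"
      using koebe_maps_holomorphic[OF P(1)] by (auto simp: koebe_zero[OF c] intro: holomorphic_derivI)
    from DERIV_chain2[OF this koebe_deriv[OF c]]
    have "deriv (\<lambda>z. P (koebe c z)) 0 = deriv P 0 * (2 * c / (1 + of_real (norm c)^2))"
      by (rule DERIV_imp_deriv)
    moreover have "norm (1 + complex_of_real (norm c)^2) = 1 + (norm c)\<^sup>2"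
    proof -
      have "1 + complex_of_real (norm c)^2 = of_real (1 + (norm c)\<^sup>2)" by simp
      then show ?thesis by (simp only: norm_of_real) simp
    qed
    ultimately have "norm (deriv (\<lambda>z. P (koebe c z)) 0)
        = norm (deriv P 0) * (2 * norm c / (1 + (norm c)\<^sup>2))"
      by (simp add: norm_mult norm_divide)
    also have "\<dots> \<le> norm (deriv P 0) * \<kappa>"
      using two_div_one_plus_square_mono[of "norm c" "sqrt M"] a M
      by (intro mult_left_mono) (auto simp: nc \<kappa>_def)
    also have "\<dots> < \<beta>" by (rule P(2))
    finally show False using \<beta>_le[of "norm (deriv (\<lambda>z. P (koebe c z)) 0)"] Q by (auto simp: \<Phi>_def)
  qed
  then have "P ` ball 0 M \<subseteq> D" by auto
  then show ?thesis by (rule that[OF P(1)])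
qed

text \<open>An affine rescaling centred at \<open>f x0\<close> puts the image of \<open>f\<close>
  into the unit disc. The bound \<open>M\<close> on all lifts is known before any covering is
  selected, so \<open>P\<close> can then be chosen to map a disc larger than \<open>M\<close> into
  the domain. The clause on connected sets is what later keeps the boundary of a cube fixed.\<close>

theorem open_planar_map_factors_through_ball:
  fixes f :: "'a::real_normed_vector \<Rightarrow> complex"
  assumes K: "compact K" "convex K" "K \<noteq> {}" and U: "open U"
    and f: "continuous_on K f" "f ` K \<subseteq> U"
  obtains q F :: "_ \<Rightarrow> complex" and r where "continuous_on (ball (0::complex) r) q" "q ` ball 0 r \<subseteq> U"
    "continuous_on K F" "F ` K \<subseteq> ball 0 r" "\<And>x. x \<in> K \<Longrightarrow> q (F x) = f x"
    "\<And>S. \<lbrakk>connected S; S \<subseteq> K; f constant_on S\<rbrakk> \<Longrightarrow> F constant_on S"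
proof -
  obtain x0 where x0: "x0 \<in> K" using K by blast
  have "compact (f ` K)" by (rule compact_continuous_image[OF f(1) K(1)])
  then obtain B where B: "B > 0" "\<And>x. x \<in> K \<Longrightarrow> dist (f x0) (f x) < B"
    using bounded_subset_ballD[OF compact_imp_bounded, of "f ` K" "f x0"]
    by (auto simp: image_subset_iff)
  define s where "s u = f x0 + of_real B * u" for u
  define D where "D = ball 0 1 \<inter> s -` U"
  define f' where "f' x = (f x - f x0) / of_real B" for x
  have sf': "s (f' x) = f x" for x using B(1) by (simp add: s_def f'_def)
  have contS: "continuous_on A s" for A unfolding s_def by (intro continuous_intros)
  have D: "open D" "D \<subseteq> ball 0 1" 
    unfolding D_def using open_vimage[OF U contS] by auto
  have D0: "0 \<in> D" using f(2) x0 by (auto simp: D_def s_def)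
  have f': "continuous_on K f'" unfolding f'_def using B(1) by (intro continuous_intros f(1)) auto
  have "norm (f' x) < 1" if "x \<in> K" for x
    using B(1) B(2)[OF that] by (simp add: f'_def norm_divide dist_commute flip: dist_norm)
  then have f'D: "f' ` K \<subseteq> D" using f(2) by (auto simp: D_def sf')
  obtain M where M: "0 \<le> M" "M < 1"
    "\<And>P F x. \<lbrakk>P \<in> koebe_maps D; continuous_on K F; F ` K \<subseteq> ball 0 1;
       \<And>y. y \<in> K \<Longrightarrow> P (F y) = f' y; F x0 = 0; x \<in> K\<rbrakk> \<Longrightarrow> norm (F x) \<le> M"
    using koebe_maps_lift_bounded[OF K(1,2) x0 D f' f'D] by blast
  \<comment> \<open>Any radius strictly between \<open>M\<close> and 1 would do: lifts satisfy only
    the non-strict bound by \<open>M\<close> and must lie in an open ball.\<close>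
  define r where "r = (M + 1) / 2"
  have r: "0 \<le> r" "r < 1" "M < r" using M by (auto simp: r_def)
  obtain P where P: "P \<in> koebe_maps D" "P ` ball 0 r \<subseteq> D"
    using koebe_maps_exhaust[OF D D0 r(1,2)] by blast
  have "P 0 = f' x0" using koebe_maps_zero[OF P(1)] by (simp add: f'_def)
  then obtain F where F: "continuous_on K F" "F ` K \<subseteq> ball 0 1" "\<And>y. y \<in> K \<Longrightarrow> P (F y) = f' y" "F x0 = 0"
    using koebe_maps_lift_continuous[OF P(1) D(2) K(2) f' f'D x0, of 0] by auto
  show ?thesis
  proof (rule that[of r "s \<circ> P" F])
    have "ball 0 r \<subseteq> (ball 0 1 :: complex set)" using r by auto
    then have "continuous_on (ball 0 r) P"
      using holomorphic_on_imp_continuous_on[OF koebe_maps_holomorphic[OF P(1)]] continuous_on_subset by blast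
    then show "continuous_on (ball 0 r) (s \<circ> P)"
      using contS by (rule continuous_on_compose)
    show "(s \<circ> P) ` ball 0 r \<subseteq> U" using P(2) by (auto simp: D_def)
    show "F ` K \<subseteq> ball 0 r" using M(3)[OF P(1) F(1-3) F(4)] r(3) by fastforce
    show "(s \<circ> P) (F x) = f x" if "x \<in> K" for x using F(3)[OF that] sf' by simp
    fix S
    assume S: "connected S" "S \<subseteq> K" and "f constant_on S"
    then have const: "f x = f y" if "x \<in> S" "y \<in> S" for x y
      using that by (auto simp: constant_on_def)
    have c: "continuous_on S F" using F(1) S(2) continuous_on_subset by blast
    \<comment> \<open>On \<open>S\<close> the constant function with value \<open>F y\<close> is
      another lift of \<open>f'\<close>, so uniqueness applies.\<close>
    have "F x = F y" if xy: "x \<in> S" "y \<in> S" for x y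
    proof (rule koebe_maps_lift_unique[OF P(1) S(1) xy(2,1) c _ continuous_on_const])
      show "P (F z) = P (F y)" if "z \<in> S" for z
      proof -
        have "z \<in> K" "y \<in> K" using that xy S by auto
        then show ?thesis using F(3) const[OF that xy(2)] by (simp add: f'_def)
      qed
      show "P (F z) \<in> D" if "z \<in> S" for z
        using that S F(3) f'D by auto
    qed (use F(2) S xy in auto)
    then show "F constant_on S" unfolding constant_on_def by blast
  qed (use F in auto)
qed

section \<open>The curve is reduced\<close>

lemma homogeneous3_vars: "homogeneous3 1 varX" "homogeneous3 1 varY" "homogeneous3 1 varZ"
  by (auto simp: homogeneous3_def varX_def varY_def varZ_def coeff_pCons split: nat.splits if_splits)

lemma homogeneous3_add:
  "\<lbrakk>homogeneous3 d F; homogeneous3 d G\<rbrakk> \<Longrightarrow> homogeneous3 d (F + G)"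
  unfolding homogeneous3_def coeff_add by (metis add.right_neutral)

lemma coeff_mult_nonzeroE:
  assumes "coeff (p * q) n \<noteq> 0"
  obtains i where "i \<le> n" "coeff p i * coeff q (n - i) \<noteq> 0"
  using assms unfolding coeff_mult by (metis (no_types, lifting) atMost_iff sum.neutral)

lemma homogeneous3_mult:
  assumes F: "homogeneous3 d F" and G: "homogeneous3 e G"
  shows "homogeneous3 (d + e) (F * G)"
  unfolding homogeneous3_def
proof (intro allI impI)
  fix i j k
  assume nz: "coeff (coeff (coeff (F * G) i) j) k \<noteq> 0"
  have "(\<Sum>a\<le>i. coeff (coeff (coeff F a * coeff G (i - a)) j) k) \<noteq> 0"
    using nz by (simp add: coeff_mult coeff_sum)
  then obtain a where a: "a \<le> i" "coeff (coeff (coeff F a * coeff G (i - a)) j) k \<noteq> 0"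
    by (metis (no_types, lifting) atMost_iff sum.neutral)
  have "(\<Sum>b\<le>j. coeff (coeff (coeff F a) b * coeff (coeff G (i - a)) (j - b)) k) \<noteq> 0"
    using a(2) by (simp add: coeff_mult[of "coeff F a"] coeff_sum)
  then obtain b where b: "b \<le> j" "coeff (coeff (coeff F a) b * coeff (coeff G (i - a)) (j - b)) k \<noteq> 0"
    by (metis (no_types, lifting) atMost_iff sum.neutral)
  obtain c where c: "c \<le> k" "coeff (coeff (coeff F a) b) c * coeff (coeff (coeff G (i - a)) (j - b)) (k - c) \<noteq> 0"
    using coeff_mult_nonzeroE[OF b(2)] by blast
  then have "coeff (coeff (coeff F a) b) c \<noteq> 0" "coeff (coeff (coeff G (i - a)) (j - b)) (k - c) \<noteq> 0"
    by auto
  then have "a + b + c = d" "(i - a) + (j - b) + (k - c) = e"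
    using F G unfolding homogeneous3_def by blast+
  then show "i + j + k = d + e" using a b c by linarith
qed

lemma homogeneous3_power:
  assumes "homogeneous3 d F"
  shows "homogeneous3 (n * d) (F ^ n)"
proof (induction n)
  case 0
  show ?case by (auto simp: homogeneous3_def coeff_1 split: if_splits)
next
  case (Suc n)
  then show ?case using homogeneous3_mult[OF assms Suc] by simp
qed

lemma square_dvd_imp_dvd_pderiv:
  fixes p :: "'a::idom poly"
  assumes "p\<^sup>2 dvd q"
  shows "p dvd q" "p dvd pderiv q"
proof -
  obtain k where k: "q = p * (p * k)" using assms by (auto simp: dvd_def power2_eq_square mult.assoc)
  show "p dvd q" by (simp add: k)
  show "p dvd pderiv q" unfolding k pderiv_mult by (intro dvd_add) simp_all
qed

lemma dvd_const_imp_degree_0: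
  fixes p :: "'a::idom poly"
  assumes "p dvd [:c:]" "c \<noteq> 0"
  shows "degree p = 0"
  using dvd_imp_degree_le[OF assms(1)] assms(2) by simp

text \<open>
  In both lemmas the discriminant enters through an explicit combination of the polynomial and its
  derivative that is a nonzero constant.
\<close>

lemma square_dvd_binomial:
  fixes p :: "'a::{idom,ring_char_0} poly"
  assumes dvd: "p\<^sup>2 dvd monom h m + [:g:]" and "m > 0" "g \<noteq> 0"
  shows "degree p = 0"
proof -
  let ?q = "monom h m + [:g:]"
  have "p dvd [:0, 1:] * pderiv ?q - of_nat m * ?q"
    using square_dvd_imp_dvd_pderiv[OF dvd] by (intro dvd_diff dvd_mult)
  also have "[:0, 1:] * pderiv ?q - of_nat m * ?q = [:- (of_nat m * g):]"
    using \<open>m > 0\<close>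
    by (intro poly_eqI)
       (auto simp: pderiv_add pderiv_monom coeff_pCons of_nat_poly algebra_simps split: nat.splits)
  finally show ?thesis by (rule dvd_const_imp_degree_0) (use assms in auto)
qed

lemma square_dvd_X_binomial:
  fixes p :: "'a::{idom,ring_char_0} poly"
  assumes dvd: "p\<^sup>2 dvd [:0, 1:] * (monom h m + [:g:])" and "m > 0" "g \<noteq> 0"
  shows "degree p = 0"
proof -
  let ?q = "[:0, 1:] * (monom h m + [:g:])"
  have q': "pderiv ?q = monom (of_nat (Suc m) * h) m + [:g:]"
    using \<open>m > 0\<close>
    by (intro poly_eqI) (auto simp: coeff_pderiv coeff_pCons algebra_simps split: nat.splits)
  have "p dvd of_nat (Suc m) * ?q - [:0, 1:] * pderiv ?q"
    by (intro dvd_diff dvd_mult[OF square_dvd_imp_dvd_pderiv(1)[OF dvd]]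
        dvd_mult[OF square_dvd_imp_dvd_pderiv(2)[OF dvd]])
  also have "of_nat (Suc m) * ?q - [:0, 1:] * pderiv ?q = [:0, of_nat m * g:]"
    unfolding q'
    by (intro poly_eqI) (auto simp: coeff_pCons of_nat_poly algebra_simps split: nat.splits)
  finally have 1: "p dvd [:0, of_nat m * g:]" .
  \<comment> \<open>The multiple of the linear polynomial just found is chosen to cancel the term of
    degree \<open>m\<close> of the derivative.\<close>
  have "p dvd smult (of_nat m * g) (pderiv ?q) - monom (of_nat (Suc m) * h) (m - 1) * [:0, of_nat m * g:]"
    using square_dvd_imp_dvd_pderiv(2)[OF dvd] 1 by (intro dvd_diff dvd_smult dvd_mult)
  also have "\<dots> = [:of_nat m * g\<^sup>2:]"
    unfolding q' using \<open>m > 0\<close>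
    by (cases m) (auto intro!: poly_eqI simp: coeff_pCons monom_Suc algebra_simps power2_eq_square split: nat.splits)
  finally show ?thesis by (rule dvd_const_imp_degree_0) (use assms in auto)
qed

lemma X_power_eq_monom: "[:0, 1:] ^ m = (monom 1 m :: 'a::comm_semiring_1 poly)"
  by (simp add: monom_altdef)

text \<open>The variables are eliminated from the outside in. In \<open>X\<close> the polynomial is
  a binomial H X^m + G with nonzero constant term, which leaves a square factor no \<open>X\<close>;
  a combination of its coefficients excludes \<open>Y\<close>; a single coefficient of
  \<open>H\<close> then excludes \<open>Z\<close>.\<close>

lemma cpoly3_factor_squarefree:
  assumes "m > 0"
  shows "squarefree (varY * varZ * (varX ^ m * varY ^ m + varY ^ m * varZ ^ m + varX ^ m * varZ ^ m)
               * (varY ^ m + varZ ^ m))" (is "squarefree ?F")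
proof (rule squarefreeI)
  fix p assume p: "p\<^sup>2 dvd ?F"
  define Y where "Y = ([:0, 1:] :: complex poly poly)"
  define Z where "Z = ([:[:0, 1:]:] :: complex poly poly)"
  define H where "H = Y * Z * (Y ^ m + Z ^ m)\<^sup>2"
  define G where "G = Y * Z * (Y ^ m + Z ^ m) * (Y ^ m * Z ^ m)"
  have vars: "varY = [:Y:]" "varZ = [:Z:]" "varX ^ m = monom 1 m"
    by (simp_all add: varX_def varY_def varZ_def Y_def Z_def X_power_eq_monom)
  have "?F = varY * varZ * (varY ^ m + varZ ^ m)\<^sup>2 * varX ^ m
      + varY * varZ * (varY ^ m + varZ ^ m) * (varY ^ m * varZ ^ m)"
    by (simp add: algebra_simps power2_eq_square)
  also have "\<dots> = [:H:] * varX ^ m + [:G:]"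
    unfolding vars(1,2) H_def G_def by (simp add: poly_const_pow mult.commute)
  finally have "?F = [:H:] * varX ^ m + [:G:]" .
  then have F: "?F = monom H m + [:G:]"
    by (simp add: vars smult_monom)
  have Zm: "Z ^ k = [:monom 1 k:]" for k
    by (simp add: Z_def poly_const_pow X_power_eq_monom)
  have Ym: "Y ^ m = monom 1 m" by (simp add: Y_def X_power_eq_monom)
  have "coeff (Y ^ m + Z ^ m) m = 1" using assms by (simp add: Ym Zm coeff_pCons split: nat.splits)
  then have "Y ^ m + Z ^ m \<noteq> 0" by (metis coeff_0 zero_neq_one)
  then have "G \<noteq> 0" by (simp add: G_def Y_def Z_def)
  have "degree p = 0" by (rule square_dvd_binomial[OF p[unfolded F] assms \<open>G \<noteq> 0\<close>])
  then obtain q where q: "p = [:q:]" by (rule degree_eq_zeroE)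
  have "q\<^sup>2 dvd coeff (monom H m + [:G:]) n" for n
    using p unfolding F q poly_const_pow const_poly_dvd_iff by blast
  from this[of m] this[of 0] have qH: "q\<^sup>2 dvd H" and qG: "q\<^sup>2 dvd G"
    using assms by (auto simp: coeff_pCons split: nat.splits)
  \<comment> \<open>Neither \<open>H\<close> nor \<open>G\<close> is squarefree: \<open>H\<close>
    contains (Y^m + Z^m)^2, and \<open>G\<close> a power of \<open>Y\<close>. In this combination
    the repeated factors in \<open>Y\<close> cancel and a binomial in \<open>Y ^ m\<close> times
    \<open>Y\<close> remains.\<close>
  have "q\<^sup>2 dvd Z ^ m * H - G" using qH qG by (intro dvd_diff dvd_mult)
  also have "Z ^ m * H - G = Y * (Z ^ (2 * m + 1) * Y ^ m + Z ^ (3 * m + 1))"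
    by (simp add: H_def G_def algebra_simps power2_eq_square power_mult power3_eq_cube power_add
        flip: power_mult_distrib)
  also have "\<dots> = [:0, 1:] * (monom (monom 1 (2 * m + 1)) m + [:monom 1 (3 * m + 1):])"
    unfolding Zm Ym by (simp add: Y_def smult_monom)
  finally have "degree q = 0" by (rule square_dvd_X_binomial) (use assms in auto)
  then obtain r where r: "q = [:r:]" by (rule degree_eq_zeroE)
  \<comment> \<open>This is the leading coefficient of \<open>H\<close> in \<open>Y\<close>, namely
    \<open>Z\<close>, which has no square factor of positive degree.\<close>
  have "r\<^sup>2 dvd coeff H (Suc (m + m))"
    using qH unfolding r poly_const_pow const_poly_dvd_iff by blast
  also have "coeff H (Suc (m + m)) = [:0, 1:]"
  proof -
    have "H = Z * (Y * (Y ^ m * Y ^ m + (2 * Z ^ m) * Y ^ m + Z ^ m * Z ^ m))"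
      by (simp add: H_def power2_eq_square algebra_simps)
    also have "\<dots> = smult [:0, 1:] (pCons 0 (monom 1 (m + m) + monom (2 * monom 1 m) m + [:monom 1 (m + m):]))"
      unfolding Ym Zm by (simp add: Y_def Z_def mult_monom numeral_poly smult_monom)
    finally show ?thesis using assms by (simp add: coeff_pCons split: nat.splits)
  qed
  finally have r2: "r\<^sup>2 dvd [:0, 1:]" .
  then have "degree (r\<^sup>2) \<le> 1" using dvd_imp_degree_le by fastforce
  moreover have "r \<noteq> 0" using r2 by auto
  ultimately have "degree r = 0" by (simp add: degree_power_eq)
  then have "is_unit r" using \<open>r \<noteq> 0\<close> by (simp add: is_unit_iff_degree)
  then show "is_unit p" by (simp add: q r is_unit_const_poly_iff)
qed

section \<open>Affine charts\<close>

lemma Rep_cproj_proj: "v \<noteq> 0 \<Longrightarrow> Rep_cproj (proj v) = range (\<lambda>c. c *s v)"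
  unfolding proj_def by (rule Abs_cproj_inverse) blast

lemma proj_cases:
  obtains v where "v \<noteq> 0" "p = proj v"
proof (cases p)
  case (Abs_cproj L)
  then show ?thesis using that by (auto simp: proj_def)
qed

lemma proj_scale:
  assumes "c \<noteq> 0"
  shows "proj (c *s v) = proj v"
proof -
  have "range (\<lambda>d. d *s (c *s v)) = range (\<lambda>d. d *s v)"
  proof (intro set_eqI iffI)
    fix x assume "x \<in> range (\<lambda>d. d *s v)"
    then obtain d where "x = d *s v" by blast
    then have "x = (d / c) *s (c *s v)" using assms by (simp add: vector_smult_assoc)
    then show "x \<in> range (\<lambda>d. d *s (c *s v))" by blast
  qed (auto simp: vector_smult_assoc)
  then show ?thesis by (simp add: proj_def)
qed

lemma proj_eqE:
  assumes "v \<noteq> 0" "w \<noteq> 0" "proj v = proj w"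
  obtains c where "c \<noteq> 0" "v = c *s w"
proof -
  have "range (\<lambda>c. c *s v) = range (\<lambda>c. c *s w)"
    using assms Rep_cproj_proj by metis
  moreover have "v \<in> range (\<lambda>c. c *s v)" by (rule range_eqI[of _ _ 1]) simp
  ultimately obtain c where "v = c *s w" by blast
  then show ?thesis using that assms(1) by (cases "c = 0") auto
qed

lemma continuous_on_proj: "continuous_on (- {0}) proj"
proof -
  have "open (proj -` U \<inter> - {0})" if "open U" for U :: "'a cproj set"
  proof -
    have "proj -` U \<inter> - {0} = {v. v \<noteq> 0 \<and> proj v \<in> U}" by auto
    then show ?thesis using that by (simp add: open_cproj_def)
  qed
  then show ?thesis by (simp add: continuous_on_open_vimage open_Compl)
qed

lemma continuous_on_cproj:
  assumes "open S" "continuous_on {v. v \<noteq> 0 \<and> proj v \<in> S} (\<lambda>v. f (proj v))"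
  shows "continuous_on S f"
  unfolding continuous_on_open_vimage[OF assms(1)]
proof (intro allI impI)
  fix T :: "'b set" assume T: "open T"
  have "open {v. v \<noteq> 0 \<and> proj v \<in> S}" using assms(1) by (simp add: open_cproj_def)
  then have "open ((\<lambda>v. f (proj v)) -` T \<inter> {v. v \<noteq> 0 \<and> proj v \<in> S})"
    using assms(2) T by (simp add: continuous_on_open_vimage)
  moreover have "(\<lambda>v. f (proj v)) -` T \<inter> {v. v \<noteq> 0 \<and> proj v \<in> S} = {v. v \<noteq> 0 \<and> proj v \<in> f -` T \<inter> S}"
    by auto
  ultimately show "open (f -` T \<inter> S)" by (simp add: open_cproj_def)
qed

definition hom_coords :: "'n::finite cproj \<Rightarrow> complex ^ 'n" where
  "hom_coords p = (SOME v. v \<noteq> 0 \<and> proj v = p)"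

lemma hom_coords_proj:
  assumes "v \<noteq> 0"
  obtains c where "c \<noteq> 0" "hom_coords (proj v) = c *s v"
proof -
  have "hom_coords (proj v) \<noteq> 0 \<and> proj (hom_coords (proj v)) = proj v"
    unfolding hom_coords_def by (rule someI[of _ v]) (use assms in simp)
  then show ?thesis using proj_eqE[of "hom_coords (proj v)" v] assms that by blast
qed

text \<open>An affine coordinate as a total function on projective space. The quotient does not
  depend on the representative chosen, and off \<open>chart j\<close> it is 0 because the divisor
  vanishes.\<close>

definition cratio :: "'n::finite \<Rightarrow> 'n \<Rightarrow> 'n cproj \<Rightarrow> complex" where
  "cratio i j p = hom_coords p $ i / hom_coords p $ j"

lemma cratio_proj: "v \<noteq> 0 \<Longrightarrow> cratio i j (proj v) = v $ i / v $ j"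
  by (elim hom_coords_proj) (simp add: cratio_def)

definition chart :: "'n::finite \<Rightarrow> 'n cproj set" where
  "chart j = {proj v | v. v $ j \<noteq> 0}"

lemma proj_in_chart_iff:
  assumes "v \<noteq> 0"
  shows "proj v \<in> chart j \<longleftrightarrow> v $ j \<noteq> 0"
proof
  assume "proj v \<in> chart j"
  then obtain w where w: "proj v = proj w" "w $ j \<noteq> 0" by (auto simp: chart_def)
  then have "w \<noteq> 0" by auto
  then obtain c where "c \<noteq> 0" "v = c *s w" using proj_eqE[OF assms _ w(1)] by blast
  then show "v $ j \<noteq> 0" using w by simp
qed (auto simp: chart_def)

lemma open_chart: "open (chart j)"
proof -
  have "{v. v \<noteq> 0 \<and> proj v \<in> chart j} = {v. v $ j \<noteq> 0}"
    by (auto simp: proj_in_chart_iff) (auto simp: chart_def)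
  also have "open \<dots>" by (intro open_Collect_neq continuous_intros)
  finally show ?thesis by (simp add: open_cproj_def)
qed

lemma continuous_on_cratio: "continuous_on (chart j) (cratio i j)"
proof (rule continuous_on_cproj[OF open_chart])
  have "continuous_on {v. v \<noteq> 0 \<and> proj v \<in> chart j} (\<lambda>v. v $ i / v $ j)"
    by (intro continuous_intros) (auto simp: proj_in_chart_iff)
  then show "continuous_on {v. v \<noteq> 0 \<and> proj v \<in> chart j} (\<lambda>v. cratio i j (proj v))"
    by (rule continuous_on_eq) (simp add: cratio_proj)
qed

definition affine_plane :: "complex \<times> complex \<Rightarrow> 3 cproj" where
  "affine_plane p = proj (\<chi> i. if i = 1 then fst p else if i = 2 then snd p else 1)"

definition affine_line :: "complex \<Rightarrow> 2 cproj" where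
  "affine_line y = proj (\<chi> i. if i = 1 then y else 1)"

lemma affine_vector_nonzero:
  "(\<chi> i. if i = 1 then x else if i = 2 then y else 1) \<noteq> (0 :: complex ^ 3)"
  "(\<chi> i. if i = 1 then y else 1) \<noteq> (0 :: complex ^ 2)"
  by (auto simp: vec_eq_iff forall_3 forall_2)

lemma affine_plane_props:
  shows cratio_affine_plane: "cratio 1 3 (affine_plane p) = fst p" "cratio 2 3 (affine_plane p) = snd p"
    and affine_plane_in_chart: "affine_plane p \<in> chart 3"
  by (simp_all add: affine_plane_def cratio_proj affine_vector_nonzero proj_in_chart_iff)

lemma affine_line_props:
  shows cratio_affine_line: "cratio 1 2 (affine_line y) = y"
    and affine_line_in_chart: "affine_line y \<in> chart 2"
  by (simp_all add: affine_line_def cratio_proj affine_vector_nonzero proj_in_chart_iff)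

lemma affine_plane_cratio:
  assumes "p \<in> chart 3"
  shows "affine_plane (cratio 1 3 p, cratio 2 3 p) = p"
proof -
  obtain v where v: "p = proj v" "v $ 3 \<noteq> 0" using assms by (auto simp: chart_def)
  then have "v \<noteq> 0" by auto
  have "(\<chi> i. if i = 1 then v $ 1 / v $ 3 else if i = 2 then v $ 2 / v $ 3 else 1) = (1 / v $ 3) *s v"
    using v(2) by (simp add: vec_eq_iff forall_3)
  then show ?thesis
    using v proj_scale[of "1 / v $ 3" v]
    by (simp add: affine_plane_def cratio_proj \<open>v \<noteq> 0\<close> cong: if_cong)
qed

lemma affine_line_cratio:
  assumes "p \<in> chart 2"
  shows "affine_line (cratio 1 2 p) = p"
proof -
  obtain v where v: "p = proj v" "v $ 2 \<noteq> 0" using assms by (auto simp: chart_def)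
  then have "v \<noteq> 0" by auto
  have "(\<chi> i. if i = 1 then v $ 1 / v $ 2 else 1) = (1 / v $ 2) *s v"
    using v(2) by (simp add: vec_eq_iff forall_2)
  then show ?thesis
    using v proj_scale[of "1 / v $ 2" v] by (simp add: affine_line_def cratio_proj \<open>v \<noteq> 0\<close>)
qed

lemma continuous_on_affine_plane: "continuous_on S affine_plane"
proof -
  have "continuous_on S (\<lambda>p. (\<chi> i. if i = 1 then fst p else if i = 2 then snd p else 1) :: complex ^ 3)"
  proof (rule continuous_on_vec_lambda)
    show "continuous_on S (\<lambda>p. if i = 1 then fst p else if i = 2 then snd p else 1)" for i :: 3
      by (cases "i = 1"; cases "i = 2") (simp_all add: continuous_on_fst continuous_on_snd)
  qed
  from continuous_on_compose2[OF continuous_on_proj this]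
  show ?thesis unfolding affine_plane_def[abs_def] using affine_vector_nonzero(1) by fastforce
qed

lemma continuous_on_affine_line: "continuous_on S affine_line"
proof -
  have "continuous_on S (\<lambda>y. (\<chi> i. if i = 1 then y else 1) :: complex ^ 2)"
  proof (rule continuous_on_vec_lambda)
    show "continuous_on S (\<lambda>y. if i = 1 then y else 1)" for i :: 2
      by (cases "i = 1") simp_all
  qed
  from continuous_on_compose2[OF continuous_on_proj this]
  show ?thesis unfolding affine_line_def[abs_def] using affine_vector_nonzero(2) by fastforce
qed

lemma open_affine_line_image:
  assumes "open T"
  shows "open (affine_line ` T)"
proof -
  have "affine_line ` T = cratio 1 2 -` T \<inter> chart 2"
    using affine_line_cratio by (force simp: cratio_affine_line affine_line_in_chart image_iff)
  then show ?thesis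
    using assms continuous_on_cratio[of "2::2" 1] by (simp add: continuous_on_open_vimage open_chart)
qed

section \<open>The affine complement\<close>

text \<open>The equation of the curve at \<open>z = 1\<close>, with x^m y^m + y^m + x^m regrouped by
  powers of \<open>x\<close>; the form without division allows the polynomial argument for
  path-connectedness.\<close>

definition affine_complement :: "nat \<Rightarrow> (complex \<times> complex) set" where
  "affine_complement m = {(x, y). y \<noteq> 0 \<and> y ^ m + 1 \<noteq> 0 \<and> x ^ m * (y ^ m + 1) + y ^ m \<noteq> 0}"

definition affine_base :: "nat \<Rightarrow> complex set" where
  "affine_base m = {y. y \<noteq> 0 \<and> y ^ m + 1 \<noteq> 0}"

lemma open_affine_base: "open (affine_base m)"
proof -
  have "affine_base m = {y. y \<noteq> 0} \<inter> {y. y ^ m + 1 \<noteq> 0}" by (auto simp: affine_base_def)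
  then show ?thesis by (simp add: open_Int open_Collect_neq continuous_intros)
qed

section \<open>Factoring maps into the affine complement through convex sets\<close>

lemma continuous_root_on_convex:
  fixes f :: "'a::real_normed_vector \<Rightarrow> complex"
  assumes "convex S" "continuous_on S f" "\<forall>x\<in>S. f x \<noteq> 0" "m > 0"
  shows "\<exists>h. continuous_on S h \<and> (\<forall>x\<in>S. h x ^ m = f x \<and> h x \<noteq> 0)"
proof -
  obtain g where g: "continuous_on S g" "\<And>x. x \<in> S \<Longrightarrow> f x = exp (g x)"
    using continuous_logarithm_on_contractible[OF assms(2) convex_imp_contractible[OF assms(1)]] assms(3)
    by metis
  show ?thesis
  proof (intro exI[of _ "\<lambda>x. exp (g x / of_nat m)"] conjI ballI)
    show "continuous_on S (\<lambda>x. exp (g x / of_nat m))"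
      using assms(4) by (intro continuous_intros g(1)) auto
    show "exp (g x / of_nat m) ^ m = f x" if "x \<in> S" for x
      using assms(4) g(2)[OF that] by (simp flip: exp_of_nat_mult)
    show "exp (g x / of_nat m) \<noteq> 0" for x by simp
  qed
qed

text \<open>Pulled back along \<open>q1\<close> to a disc, the fibration becomes a product: in the
  coordinate \<open>x / w\<close> the punctures are the m-th roots of unity, independently of the
  base point. The second planar factorization can therefore use one fixed open set, and the product
  of two discs is convex.\<close>

lemma affine_complement_map_factors:
  fixes f :: "'a::real_normed_vector \<Rightarrow> complex \<times> complex"
  assumes m: "m > 0" and K: "compact K" "convex K" "K \<noteq> {}"
    and f: "continuous_on K f" "f ` K \<subseteq> affine_complement m"
  obtains C :: "(complex \<times> complex) set" and G F where "convex C" "continuous_on C G"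
    "G ` C \<subseteq> affine_complement m" "continuous_on K F" "F ` K \<subseteq> C" "\<And>x. x \<in> K \<Longrightarrow> G (F x) = f x"
    "\<And>S. \<lbrakk>connected S; S \<subseteq> K; f constant_on S\<rbrakk> \<Longrightarrow> F constant_on S"
proof -
  have fW: "snd (f k) \<in> affine_base m" "fst (f k) ^ m * (snd (f k) ^ m + 1) + snd (f k) ^ m \<noteq> 0"
    if "k \<in> K" for k
    using f(2) that by (auto simp: affine_complement_def affine_base_def)
  have sub: "(\<lambda>k. snd (f k)) ` K \<subseteq> affine_base m" using fW by auto
  obtain q1 F1 r1 where 1: "continuous_on (ball (0::complex) r1) q1" "q1 ` ball 0 r1 \<subseteq> affine_base m"
    "continuous_on K F1" "F1 ` K \<subseteq> ball 0 r1" "\<And>k. k \<in> K \<Longrightarrow> q1 (F1 k) = snd (f k)"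
    and F1: "\<And>S. \<lbrakk>connected S; S \<subseteq> K; (\<lambda>k. snd (f k)) constant_on S\<rbrakk> \<Longrightarrow> F1 constant_on S"
    by (rule open_planar_map_factors_through_ball[OF K open_affine_base continuous_on_snd[OF f(1)] sub])
       (rule that; (assumption | blast))
  define g where "g u = - (q1 u ^ m) / (q1 u ^ m + 1)" for u
  have q1: "q1 u \<noteq> 0" "q1 u ^ m + 1 \<noteq> 0" if "u \<in> ball 0 r1" for u
    using 1(2) that unfolding affine_base_def by blast+
  have g: "continuous_on (ball 0 r1) g"
    unfolding g_def[abs_def] by (intro continuous_intros 1(1) ballI q1(2))
  have g0: "\<forall>u\<in>ball 0 r1. g u \<noteq> 0"
    unfolding g_def using q1 by simp
  obtain w where w: "continuous_on (ball 0 r1) w" "\<And>u. u \<in> ball 0 r1 \<Longrightarrow> w u ^ m = g u"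
    "\<And>u. u \<in> ball 0 r1 \<Longrightarrow> w u \<noteq> 0"
    using continuous_root_on_convex[OF convex_ball g g0 m] by metis
  define U where "U = {x :: complex. x ^ m \<noteq> 1}"
  have U: "open U" unfolding U_def by (intro open_Collect_neq continuous_intros)
  \<comment> \<open>In the coordinate \<open>x / w\<close> the third factor of the equation splits
    into a nonvanishing function of the base and 1 - x^m.\<close>
  have wmul: "(x * w u) ^ m * (q1 u ^ m + 1) + q1 u ^ m = q1 u ^ m * (1 - x ^ m)"
    if "u \<in> ball 0 r1" for x u
  proof -
    have "g u * (q1 u ^ m + 1) = - (q1 u ^ m)" using q1(2)[OF that] by (simp add: g_def)
    moreover have "(x * w u) ^ m * (q1 u ^ m + 1) = x ^ m * (g u * (q1 u ^ m + 1))"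
      by (simp only: power_mult_distrib w(2)[OF that] mult.assoc)
    ultimately show ?thesis by (simp add: right_diff_distrib)
  qed
  define f2 where "f2 k = fst (f k) / w (F1 k)" for k
  have wF1: "w (F1 k) \<noteq> 0" if "k \<in> K" for k using w(3) 1(4) that by blast
  have f2: "continuous_on K f2"
    unfolding f2_def
    by (intro continuous_intros f(1) continuous_on_compose2[OF w(1) 1(3,4)]) (use wF1 in auto)
  have "f2 k \<in> U" if k: "k \<in> K" for k
  proof -
    have "f2 k * w (F1 k) = fst (f k)" using wF1[OF k] by (simp add: f2_def)
    then show ?thesis
      using wmul[of "F1 k" "f2 k"] fW(2)[OF k] 1(4,5) k by (auto simp: U_def image_subset_iff)
  qed
  then have sub2: "f2 ` K \<subseteq> U" by auto
  obtain q2 F2 r2 where 2: "continuous_on (ball (0::complex) r2) q2" "q2 ` ball 0 r2 \<subseteq> U"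
    "continuous_on K F2" "F2 ` K \<subseteq> ball 0 r2" "\<And>k. k \<in> K \<Longrightarrow> q2 (F2 k) = f2 k"
    and F2: "\<And>S. \<lbrakk>connected S; S \<subseteq> K; f2 constant_on S\<rbrakk> \<Longrightarrow> F2 constant_on S"
    by (rule open_planar_map_factors_through_ball[OF K U f2 sub2])
       (rule that; (assumption | blast))
  let ?C = "ball (0::complex) r2 \<times> ball (0::complex) r1"
  show ?thesis
  proof (rule that[of ?C "\<lambda>(u, v). (q2 u * w v, q1 v)" "\<lambda>k. (F2 k, F1 k)"])
    show "convex ?C" by (intro convex_Times convex_ball)
    show "continuous_on ?C (\<lambda>(u, v). (q2 u * w v, q1 v))"
    proof -
      have c: "continuous_on ?C fst" "continuous_on ?C snd" "fst ` ?C \<subseteq> ball 0 r2" "snd ` ?C \<subseteq> ball 0 r1"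
        by (rule continuous_on_fst[OF continuous_on_id] continuous_on_snd[OF continuous_on_id] | force)+
      show ?thesis
        unfolding case_prod_beta
        by (rule continuous_on_Pair continuous_on_mult continuous_on_compose2[OF 2(1) c(1,3)]
            continuous_on_compose2[OF w(1) c(2,4)] continuous_on_compose2[OF 1(1) c(2,4)])+
    qed
    show "(\<lambda>(u, v). (q2 u * w v, q1 v)) ` ?C \<subseteq> affine_complement m"
    proof clarify
      fix u v :: complex assume uv: "u \<in> ball 0 r2" "v \<in> ball 0 r1"
      have "q2 u \<in> U" using 2(2) uv by blast
      then show "(q2 u * w v, q1 v) \<in> affine_complement m"
        using q1[OF uv(2)] by (simp add: affine_complement_def wmul[OF uv(2)] U_def)
    qed
    show "continuous_on K (\<lambda>k. (F2 k, F1 k))" by (intro continuous_intros 1 2)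
    show "(\<lambda>k. (F2 k, F1 k)) ` K \<subseteq> ?C" using 1(4) 2(4) by auto
    show "(case (F2 k, F1 k) of (u, v) \<Rightarrow> (q2 u * w v, q1 v)) = f k" if "k \<in> K" for k
      using 1(5)[OF that] 2(5)[OF that] wF1[OF that] by (simp add: f2_def)
    fix S assume S: "connected S" "S \<subseteq> K" and const: "f constant_on S"
    have eq1: "F1 constant_on S"
      by (rule F1[OF S]) (use const in \<open>auto simp: constant_on_def\<close>)
    \<comment> \<open>The divisor in \<open>f2\<close> depends on the point only through
      \<open>F1\<close>, which is already constant on \<open>S\<close>.\<close>
    have "f2 constant_on S"
      using eq1 const by (auto simp: f2_def constant_on_def)
    then have "F2 constant_on S" by (rule F2[OF S])
    then show "(\<lambda>k. (F2 k, F1 k)) constant_on S" using eq1 by (auto simp: constant_on_def)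
  qed
qed

text \<open>The complex line through two points of the complement meets the curve where a polynomial
  in one parameter vanishes. It is nonzero at the parameter 0, so finitely many parameters are lost,
  and the plane of parameters stays path-connected.\<close>

lemma path_connected_affine_complement: "path_connected (affine_complement m)"
  unfolding path_connected_component
proof (intro ballI)
  fix a b assume ab: "a \<in> affine_complement m" "b \<in> affine_complement m"
  define X where "X = [:fst a, fst b - fst a:]"
  define Y where "Y = [:snd a, snd b - snd a:]"
  define N where "N = Y * (Y ^ m + 1) * (X ^ m * (Y ^ m + 1) + Y ^ m)"
  define T where "T = - {t. poly N t = 0}"
  have mem: "(poly X t, poly Y t) \<in> affine_complement m \<longleftrightarrow> t \<in> T" for t
    by (simp add: N_def T_def affine_complement_def)
  have T01: "0 \<in> T" "1 \<in> T"
    using ab mem[of 0] mem[of 1] by (simp_all add: X_def Y_def)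
  then have "N \<noteq> 0" by (auto simp: T_def)
  then have "finite {t. poly N t = 0}" by (rule poly_roots_finite)
  then have "path_connected T"
    unfolding T_def by (intro path_connected_complement_countable countable_finite) auto
  then have "path_connected ((\<lambda>t. (poly X t, poly Y t)) ` T)"
    by (rule path_connected_continuous_image[rotated]) (intro continuous_intros)
  moreover have "a \<in> (\<lambda>t. (poly X t, poly Y t)) ` T"
    by (rule image_eqI[OF _ T01(1)]) (simp add: X_def Y_def)
  moreover have "b \<in> (\<lambda>t. (poly X t, poly Y t)) ` T"
    by (rule image_eqI[OF _ T01(2)]) (simp add: X_def Y_def)
  ultimately have "path_component ((\<lambda>t. (poly X t, poly Y t)) ` T) a b"
    unfolding path_connected_component by blast
  then show "path_component (affine_complement m) a b"
    by (rule path_component_of_subset[rotated]) (auto simp: mem)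
qed

section \<open>Asphericity\<close>

text \<open>
  The cubes of all dimensions are embedded into a single normed space, so that convexity and the
  logarithm of a nonvanishing continuous function on a contractible set are available for them.
\<close>

definition unit_seq :: "nat \<Rightarrow> nat \<Rightarrow>\<^sub>C real" where
  "unit_seq i = Bcontfun (\<lambda>j. of_bool (j = i))"

lemma apply_unit_seq: "apply_bcontfun (unit_seq i) j = of_bool (j = i)"
proof -
  have "(\<lambda>j. of_bool (j = i) :: real) \<in> bcontfun"
    by (auto simp: bcontfun_def intro!: boundedI[of _ 1])
  then show ?thesis by (simp add: unit_seq_def Bcontfun_inverse)
qed

definition cube_vector :: "nat \<Rightarrow> (nat \<Rightarrow> real) \<Rightarrow> nat \<Rightarrow>\<^sub>C real" where
  "cube_vector n t = (\<Sum>i<n. t i *\<^sub>R unit_seq i)"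

lemma apply_cube_vector: "apply_bcontfun (cube_vector n t) j = (if j < n then t j else 0)"
proof -
  have "apply_bcontfun (\<Sum>i<k. t i *\<^sub>R unit_seq i) j = (\<Sum>i<k. t i * of_bool (j = i))" for k
    by (induction k) (simp_all add: plus_bcontfun.rep_eq scaleR_bcontfun.rep_eq apply_unit_seq)
  then show ?thesis by (simp add: cube_vector_def)
qed

lemma topspace_cube: "topspace (cube n) = {..<n} \<rightarrow>\<^sub>E {0..1}"
  by (simp add: cube_def)

definition vector_cube :: "nat \<Rightarrow> (nat \<Rightarrow>\<^sub>C real) set" where
  "vector_cube n = cube_vector n ` topspace (cube n)"

lemma vector_cube_iff:
  "v \<in> vector_cube n \<longleftrightarrow> (\<forall>i<n. apply_bcontfun v i \<in> {0..1}) \<and> (\<forall>i\<ge>n. apply_bcontfun v i = 0)"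
    (is "_ = ?rhs")
proof
  assume "v \<in> vector_cube n"
  then obtain t where t: "t \<in> {..<n} \<rightarrow>\<^sub>E {0..1}" "v = cube_vector n t"
    unfolding vector_cube_def topspace_cube by blast
  show ?rhs
    unfolding t(2) apply_cube_vector using PiE_mem[OF t(1)] by auto
next
  assume r: ?rhs
  have "v = cube_vector n (restrict (apply_bcontfun v) {..<n})"
    by (rule bcontfun_eqI) (use r in \<open>simp add: apply_cube_vector\<close>)
  moreover have "restrict (apply_bcontfun v) {..<n} \<in> topspace (cube n)"
    using r by (auto simp: topspace_cube)
  ultimately show "v \<in> vector_cube n" unfolding vector_cube_def by blast
qed

lemma continuous_map_cube_vector: "continuous_map (cube n) euclidean (cube_vector n)"
proof -
  have "continuous_map (cube n) euclidean (\<lambda>t. t i *\<^sub>R unit_seq i)" if "i < n" for i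
  proof -
    have "continuous_map (cube n) (top_of_set {0..1}) (\<lambda>t. t i)"
      unfolding cube_def by (rule continuous_map_product_projection) (use that in simp)
    then have "continuous_map (cube n) euclidean (\<lambda>t. t i)"
      by (simp add: continuous_map_in_subtopology)
    moreover have "continuous_map euclidean euclidean (\<lambda>s::real. s *\<^sub>R unit_seq i)"
      unfolding continuous_map_iff_continuous2 by (intro continuous_intros)
    ultimately have "continuous_map (cube n) euclidean ((\<lambda>s. s *\<^sub>R unit_seq i) \<circ> (\<lambda>t. t i))"
      by (rule continuous_map_compose)
    then show ?thesis by (simp add: o_def)
  qed
  then show ?thesis
    unfolding cube_vector_def[abs_def] by (intro continuous_map_sum) auto
qed

lemma compact_vector_cube: "compact (vector_cube n)"
proof -
  have "compact_space (cube n)"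
    unfolding cube_def compact_space_product_topology
    by (simp add: compact_space_subtopology compactin_euclidean_iff)
  then have "compactin (cube n) (topspace (cube n))" by (simp add: compact_space_def)
  from image_compactin[OF this continuous_map_cube_vector] show ?thesis
    by (simp add: vector_cube_def compactin_euclidean_iff)
qed

text \<open>Proved for arbitrary \<open>i\<close> and \<open>c\<close> to cover both uses: the faces
  of the cube, and the cube itself, for which \<open>i = n\<close> and \<open>c = 0\<close> impose
  no condition.\<close>

lemma convex_vector_cube_face: "convex {v \<in> vector_cube n. apply_bcontfun v i = c}"
proof (rule convexI)
  fix v w :: "nat \<Rightarrow>\<^sub>C real" and a b :: real
  assume ab: "0 \<le> a" "0 \<le> b" "a + b = 1"
    and "v \<in> {v \<in> vector_cube n. apply_bcontfun v i = c}" "w \<in> {v \<in> vector_cube n. apply_bcontfun v i = c}"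
  then have vw: "v \<in> vector_cube n" "w \<in> vector_cube n" "apply_bcontfun v i = c" "apply_bcontfun w i = c"
    by auto
  have ap: "apply_bcontfun (a *\<^sub>R v + b *\<^sub>R w) j = a * apply_bcontfun v j + b * apply_bcontfun w j" for j
    by (simp add: plus_bcontfun.rep_eq scaleR_bcontfun.rep_eq)
  have "a *\<^sub>R v + b *\<^sub>R w \<in> vector_cube n"
    unfolding vector_cube_iff ap
  proof (intro conjI allI impI)
    fix j assume "j < n"
    then have "apply_bcontfun v j \<in> {0..1}" "apply_bcontfun w j \<in> {0..1}"
      using vw by (auto simp: vector_cube_iff)
    then show "a * apply_bcontfun v j + b * apply_bcontfun w j \<in> {0..1}"
      using convexD[OF convex_real_interval(5)[of 0 "1::real"], of "apply_bcontfun v j" "apply_bcontfun w j" a b] ab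
      by simp
  qed (use vw in \<open>simp add: vector_cube_iff\<close>)
  moreover have "apply_bcontfun (a *\<^sub>R v + b *\<^sub>R w) i = c"
    unfolding ap vw(3,4) using ab by (simp flip: distrib_right)
  ultimately show "a *\<^sub>R v + b *\<^sub>R w \<in> {v \<in> vector_cube n. apply_bcontfun v i = c}" by simp
qed

lemma convex_vector_cube: "convex (vector_cube n)"
proof -
  have "vector_cube n = {v \<in> vector_cube n. apply_bcontfun v n = 0}"
    by (auto simp: vector_cube_iff)
  then show ?thesis using convex_vector_cube_face by metis
qed

definition cube_point :: "nat \<Rightarrow> (nat \<Rightarrow>\<^sub>C real) \<Rightarrow> nat \<Rightarrow> real" where
  "cube_point n v = restrict (apply_bcontfun v) {..<n}"

lemma cube_point_cube_vector: "t \<in> topspace (cube n) \<Longrightarrow> cube_point n (cube_vector n t) = t"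
  by (auto simp: cube_point_def apply_cube_vector topspace_cube PiE_iff extensional_def fun_eq_iff)

lemma continuous_map_cube_point: "continuous_map (top_of_set (vector_cube n)) (cube n) (cube_point n)"
  unfolding cube_def continuous_map_componentwise
proof (intro conjI ballI)
  show "cube_point n ` topspace (top_of_set (vector_cube n)) \<subseteq> extensional {..<n}"
    by (auto simp: cube_point_def)
  fix i assume i: "i \<in> {..<n}"
  have "continuous_on (vector_cube n) (\<lambda>v. apply_bcontfun v i)"
    unfolding continuous_on_iff using dist_fun_lt_imp_dist_val_lt by blast
  moreover have "(\<lambda>v. apply_bcontfun v i) \<in> vector_cube n \<rightarrow> {0..1}"
    using i by (auto simp: vector_cube_iff)
  ultimately show "continuous_map (top_of_set (vector_cube n)) (top_of_set {0..1}) (\<lambda>v. cube_point n v i)"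
    using i by (simp add: cube_point_def continuous_map_in_subtopology continuous_map_iff_continuous)
qed

text \<open>
  The factors of \<open>f\<close> are constant on each (convex) face of the cube; as \<open>n \<ge> 2\<close>, the faces chain
  together, so the straight-line homotopy in the convex set fixes the boundary.
\<close>

lemma trivial_homotopy_group_if_factors:
  fixes X :: "'b::topological_space set"
  assumes factors: "\<And>f. \<lbrakk>continuous_on (vector_cube n) f; f ` vector_cube n \<subseteq> X\<rbrakk> \<Longrightarrow>
      \<exists>(C :: 'c::real_normed_vector set) G F. convex C \<and> continuous_on C G \<and> G ` C \<subseteq> X \<and>
        continuous_on (vector_cube n) F \<and> F ` vector_cube n \<subseteq> C \<and> (\<forall>v\<in>vector_cube n. G (F v) = f v) \<and>
        (\<forall>S\<subseteq>vector_cube n. connected S \<and> f constant_on S \<longrightarrow> F constant_on S)"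
    and n: "n \<ge> 2"
  shows "trivial_homotopy_group n (top_of_set X) a"
  unfolding trivial_homotopy_group_def
proof (intro allI impI, elim conjE)
  fix f assume f: "continuous_map (cube n) (top_of_set X) f" and fa: "\<forall>t\<in>cube_boundary n. f t = a"
  let ?K = "vector_cube n" and ?e = "cube_vector n" and ?r = "cube_point n"
  have "continuous_map (top_of_set ?K) (top_of_set X) (f \<circ> ?r)"
    by (rule continuous_map_compose[OF continuous_map_cube_point f])
  then have "continuous_on ?K (f \<circ> ?r)" "(f \<circ> ?r) ` ?K \<subseteq> X" by auto
  from factors[OF this] obtain C :: "'c set" and G F where C: "convex C" "continuous_on C G" "G ` C \<subseteq> X"
    and F: "continuous_on ?K F" "F ` ?K \<subseteq> C" "\<And>v. v \<in> ?K \<Longrightarrow> G (F v) = f (?r v)"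
    and const: "\<And>S. \<lbrakk>S \<subseteq> ?K; connected S; (f \<circ> ?r) constant_on S\<rbrakk> \<Longrightarrow> F constant_on S"
    by (auto simp: o_def)
  have r_bd: "?r v \<in> cube_boundary n" if "v \<in> ?K" "i < n" "apply_bcontfun v i \<in> {0, 1}" for v i
  proof -
    have "?r v \<in> topspace (cube n)"
      using continuous_map_cube_point that(1) by (auto simp: continuous_map_def)
    moreover have "?r v i = apply_bcontfun v i" using that(2) by (simp add: cube_point_def)
    ultimately show ?thesis using that by (auto simp: cube_boundary_def)
  qed
  have face: "F v = F w" if "v \<in> ?K" "w \<in> ?K" "i < n" "apply_bcontfun v i = c" "apply_bcontfun w i = c" "c \<in> {0, 1}"
    for v w i c
  proof -
    let ?S = "{v \<in> ?K. apply_bcontfun v i = c}"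
    have "F constant_on ?S"
    proof (rule const)
      have "f (?r v) = a" if "v \<in> ?S" for v
        using that r_bd[of v i] fa \<open>i < n\<close> \<open>c \<in> _\<close> by auto
      then show "(f \<circ> ?r) constant_on ?S" by (auto simp: constant_on_def)
    qed (use convex_connected[OF convex_vector_cube_face] in auto)
    then show ?thesis using that by (auto simp: constant_on_def)
  qed
  have 0: "0 \<in> ?K" by (simp add: vector_cube_iff)
  have F0: "F (?e t) = F 0" if t: "t \<in> cube_boundary n" for t
  proof -
    obtain i where i: "i < n" "t i = 0 \<or> t i = 1" and tt: "t \<in> topspace (cube n)"
      using t by (auto simp: cube_boundary_def)
    have et: "?e t \<in> ?K" using tt by (auto simp: vector_cube_def)
    have eti: "apply_bcontfun (?e t) i = t i" using i by (simp add: apply_cube_vector)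
    show ?thesis
    proof (cases "t i = 0")
      case True
      then show ?thesis using face[OF et 0 i(1), of 0] eti by simp
    next
      case False
      \<comment> \<open>A coordinate other than \<open>i\<close>, available since
        \<open>n \<ge> 2\<close>. The vertex \<open>unit_seq i\<close> lies both on the face where
        coordinate \<open>i\<close> is 1 and on the face where coordinate \<open>j\<close> is 0, and
        so links the former to the origin.\<close>
      define j :: nat where "j = (if i = 0 then 1 else 0)"
      have j: "j < n" "j \<noteq> i" using n by (auto simp: j_def)
      have u: "unit_seq i \<in> ?K" using i(1) by (auto simp: vector_cube_iff apply_unit_seq)
      have "F (?e t) = F (unit_seq i)"
        using face[OF et u i(1), of 1] eti False i(2) by (simp add: apply_unit_seq)
      also have "\<dots> = F 0"
        using face[OF u 0 j(1), of 0] j(2) by (simp add: apply_unit_seq)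
      finally show ?thesis .
    qed
  qed
  have r0: "?r 0 \<in> cube_boundary n" using r_bd[OF 0, of 0] n by simp
  define L where "L p = (1 - fst p) *\<^sub>R snd p + fst p *\<^sub>R F 0" for p :: "real \<times> 'c"
  let ?P = "prod_topology (top_of_set {0..1::real}) (cube n)"
  have Fe: "continuous_map (cube n) euclidean (\<lambda>t. F (?e t))"
  proof -
    have "continuous_map (cube n) (top_of_set ?K) ?e"
      using continuous_map_cube_vector by (auto simp: continuous_map_in_subtopology vector_cube_def)
    moreover have "continuous_map (top_of_set ?K) euclidean F"
      using F(1) by (simp add: continuous_map_iff_continuous)
    ultimately have "continuous_map (cube n) euclidean (F \<circ> ?e)"
      by (rule continuous_map_compose)
    then show ?thesis by (simp add: o_def)
  qed
  have "continuous_map ?P euclidean (\<lambda>p. (fst p, F (?e (snd p))))"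
  proof -
    have "continuous_map ?P (top_of_set {0..1}) fst" by (rule continuous_map_fst)
    then have "continuous_map ?P euclidean fst" by (simp add: continuous_map_in_subtopology)
    moreover have "continuous_map ?P euclidean ((\<lambda>t. F (?e t)) \<circ> snd)"
      by (rule continuous_map_compose[OF continuous_map_snd Fe])
    ultimately have "continuous_map ?P (prod_topology euclidean euclidean) (\<lambda>p. (fst p, F (?e (snd p))))"
      unfolding o_def by (rule continuous_map_pairedI)
    then show ?thesis by (simp only: prod_topology_euclidean)
  qed
  moreover have "continuous_map euclidean euclidean L"
    unfolding L_def[abs_def] continuous_map_iff_continuous2 by (intro continuous_intros)
  ultimately have "continuous_map ?P euclidean (L \<circ> (\<lambda>p. (fst p, F (?e (snd p)))))"
    by (rule continuous_map_compose)
  moreover have LC: "L (s, F (?e t)) \<in> C" if "s \<in> {0..1}" "t \<in> topspace (cube n)" for s t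
  proof -
    have "F (?e t) \<in> C" "F 0 \<in> C" using that F(2) 0 by (auto simp: vector_cube_def)
    then show ?thesis unfolding L_def using C(1) that(1) by (auto intro!: convexD)
  qed
  ultimately have "continuous_map ?P (top_of_set C) (\<lambda>p. L (fst p, F (?e (snd p))))"
    by (auto simp: continuous_map_in_subtopology o_def)
  moreover have "continuous_map (top_of_set C) (top_of_set X) G"
    using C by (auto simp: continuous_map_in_subtopology continuous_map_iff_continuous)
  ultimately have "continuous_map ?P (top_of_set X) (G \<circ> (\<lambda>p. L (fst p, F (?e (snd p)))))"
    by (rule continuous_map_compose)
  then have H: "continuous_map ?P (top_of_set X) (\<lambda>p. G (L (fst p, F (?e (snd p)))))"
    by (simp add: o_def)
  have G0: "G (F 0) = a" using F(3)[OF 0] fa r0 by simp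
  have Gf: "G (F (?e t)) = f t" if "t \<in> topspace (cube n)" for t
    using F(3)[of "?e t"] that by (simp add: vector_cube_def cube_point_cube_vector)
  \<comment> \<open>The characterization of \<open>homotopic_with\<close> used next requires that
    the condition on maps depend only on their values on the cube.\<close>
  have "(\<forall>t\<in>cube_boundary n. h t = a) \<longleftrightarrow> (\<forall>t\<in>cube_boundary n. k t = a)"
    if "\<And>t. t \<in> topspace (cube n) \<Longrightarrow> h t = k t" for h k :: "(nat \<Rightarrow> real) \<Rightarrow> 'b"
    using that by (auto simp: cube_boundary_def)
  then show "homotopic_with (\<lambda>h. \<forall>t\<in>cube_boundary n. h t = a) (cube n) (top_of_set X) f (\<lambda>_. a)"
  proof (subst homotopic_with, blast, intro exI[of _ "\<lambda>p. G (L (fst p, F (?e (snd p))))"] conjI ballI)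
    show "continuous_map ?P (top_of_set X) (\<lambda>p. G (L (fst p, F (?e (snd p)))))" by (rule H)
    show "G (L (fst (0::real, t), F (?e (snd (0::real, t))))) = f t" if "t \<in> topspace (cube n)" for t
      using Gf[OF that] by (simp add: L_def)
    show "G (L (fst (1::real, t), F (?e (snd (1::real, t))))) = a" for t
      using G0 by (simp add: L_def)
    show "G (L (fst (s, t), F (?e (snd (s, t))))) = a" if "t \<in> cube_boundary n" for s :: real and t
      using G0 F0[OF that] by (simp add: L_def flip: scaleR_left_distrib)
  qed
qed

section \<open>The projection from \<open>(1 : 0 : 0)\<close>\<close>

lemma affine_complement_iff:
  "(x, y) \<in> affine_complement m \<longleftrightarrow> y \<in> affine_base m \<and> x ^ m \<noteq> - (y ^ m) / (y ^ m + 1)"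
proof (cases "y \<in> affine_base m")
  case True
  then have "y ^ m + 1 \<noteq> 0" by (simp add: affine_base_def)
  then have "x ^ m = - (y ^ m) / (y ^ m + 1) \<longleftrightarrow> x ^ m * (y ^ m + 1) + y ^ m = 0"
    by (simp only: eq_divide_eq eq_neg_iff_add_eq_0 not_False_eq_True if_True)
  then show ?thesis using True by (simp add: affine_complement_def affine_base_def)
qed (auto simp: affine_complement_def affine_base_def)

lemma affine_plane_eq_iff: "affine_plane p = affine_plane q \<longleftrightarrow> p = q"
  by (metis cratio_affine_plane prod_eq_iff)

lemma affine_line_eq_iff: "affine_line y = affine_line z \<longleftrightarrow> y = z"
  by (metis cratio_affine_line)

text \<open>
  Over a disc around \<open>y0\<close>, multiplication by an \<open>m\<close>-th root of \<open>g y / g y0\<close> carries the punctures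
  \<open>x ^ m = g y0\<close> of the fibre over \<open>y0\<close> to those of the fibre over \<open>y\<close>.
\<close>

lemma locally_trivial_affine_complement:
  assumes m: "m > 0" and E: "E = affine_plane ` affine_complement m"
    and \<pi>: "\<And>x y. \<pi> (affine_plane (x, y)) = affine_line y"
  shows "locally_trivial_fibration (top_of_set E) (top_of_set (\<pi> ` E)) \<pi>"
  unfolding locally_trivial_fibration_def
proof (intro conjI ballI)
  have E_chart: "E \<subseteq> chart 3" using affine_plane_in_chart by (auto simp: E)
  have \<pi>E: "\<pi> q = affine_line (cratio 2 3 q)" if "q \<in> E" for q
    using that by (auto simp: E \<pi> cratio_affine_plane)
  have cE: "continuous_on S (cratio i 3)" if "S \<subseteq> E" for S i
    using continuous_on_subset[OF continuous_on_cratio] E_chart that by blast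
  have "continuous_on E (\<lambda>q. affine_line (cratio 2 3 q))"
    by (rule continuous_on_compose2[OF continuous_on_affine_line[of UNIV] cE]) auto
  then have "continuous_on E \<pi>" by (rule continuous_on_eq) (simp add: \<pi>E)
  then show "continuous_map (top_of_set E) (top_of_set (\<pi> ` E)) \<pi>"
    by (auto simp: continuous_map_in_subtopology)
  show "\<pi> ` topspace (top_of_set E) = topspace (top_of_set (\<pi> ` E))" by simp
  fix b assume "b \<in> topspace (top_of_set (\<pi> ` E))"
  then obtain y0 where b: "b = affine_line y0" and y0: "y0 \<in> affine_base m"
    by (auto simp: E \<pi> affine_complement_iff)
  define g where "g y = - (y ^ m) / (y ^ m + 1)" for y :: complex
  have W: "(x, y) \<in> affine_complement m \<longleftrightarrow> y \<in> affine_base m \<and> x ^ m \<noteq> g y" for x y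
    by (simp add: affine_complement_iff g_def)
  have g0: "g y \<noteq> 0" if "y \<in> affine_base m" for y
    using that by (simp add: g_def affine_base_def)
  obtain \<epsilon> where \<epsilon>: "\<epsilon> > 0" "ball y0 \<epsilon> \<subseteq> affine_base m"
    using open_affine_base y0 openE by blast
  let ?B = "ball y0 \<epsilon>"
  have nz: "\<forall>y\<in>?B. y ^ m + 1 \<noteq> 0" using \<epsilon>(2) unfolding affine_base_def by blast
  have "continuous_on ?B g"
    unfolding g_def[abs_def] by (intro continuous_intros nz)
  then have cg: "continuous_on ?B (\<lambda>y. g y / g y0)"
    using g0[OF y0] by (intro continuous_on_divide continuous_on_const) auto
  have "g y \<noteq> 0" if "y \<in> ?B" for y using g0 \<epsilon>(2) that by blast
  then have "\<forall>y\<in>?B. g y / g y0 \<noteq> 0" using g0[OF y0] by simp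
  from continuous_root_on_convex[OF convex_ball cg this m] obtain h where h: "continuous_on ?B h" "\<And>y. y \<in> ?B \<Longrightarrow> h y ^ m = g y / g y0"
    "\<And>y. y \<in> ?B \<Longrightarrow> h y \<noteq> 0"
    by blast
  \<comment> \<open>Scaling by \<open>h y\<close> is compatible with the punctures, since h(y)^m
    g(y0) = g(y).\<close>
  have hW: "(h y * x, y) \<in> affine_complement m \<longleftrightarrow> (x, y0) \<in> affine_complement m" if "y \<in> ?B" for x y
  proof -
    have "(h y * x) ^ m = g y \<longleftrightarrow> x ^ m = g y0"
    proof -
      have "g y = h y ^ m * g y0" using g0[OF y0] h(2)[OF that] by simp
      then show ?thesis using h(3)[OF that] by (simp add: power_mult_distrib)
    qed
    then show ?thesis using W that \<epsilon>(2) y0 by auto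
  qed
  define U where "U = affine_line ` ?B"
  define Fib where "Fib = {e \<in> E. \<pi> e = b}"
  define EU where "EU = {e \<in> E. \<pi> e \<in> U}"
  have Fib: "e \<in> Fib \<longleftrightarrow> (\<exists>x. e = affine_plane (x, y0) \<and> (x, y0) \<in> affine_complement m)" for e
    by (auto simp: Fib_def E \<pi> b affine_line_eq_iff)
  have EU: "e \<in> EU \<longleftrightarrow> (\<exists>x y. e = affine_plane (x, y) \<and> y \<in> ?B \<and> (x, y) \<in> affine_complement m)" for e
    unfolding EU_def E U_def by (force simp: \<pi> affine_line_eq_iff)
  \<comment> \<open>Every fibre over the disc contains the point with \<open>x = 0\<close>, because
    \<open>g\<close> does not vanish; so the disc lies in the image of the projection.\<close>
  have UE: "U \<subseteq> \<pi> ` E"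
  proof
    fix u assume "u \<in> U"
    then obtain y where y: "u = affine_line y" "y \<in> affine_base m" using \<epsilon>(2) by (auto simp: U_def)
    then have "(0, y) \<in> affine_complement m" using W g0[of y] m by (simp add: zero_power)
    then show "u \<in> \<pi> ` E" using y \<pi>[of 0 y] by (force simp: E)
  qed
  define \<phi> :: "2 cproj \<times> 3 cproj \<Rightarrow> 3 cproj" where
    "\<phi> = (\<lambda>(u, e). affine_plane (h (cratio 1 2 u) * cratio 1 3 e, cratio 1 2 u))"
  define \<psi> where "\<psi> q = (affine_line (cratio 2 3 q), affine_plane (cratio 1 3 q / h (cratio 2 3 q), y0))"
    for q :: "3 cproj"
  have \<phi>: "\<phi> (affine_line y, affine_plane (x, z)) = affine_plane (h y * x, y)" for x y z
    by (simp add: \<phi>_def cratio_affine_line cratio_affine_plane)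
  have \<psi>: "\<psi> (affine_plane (x, y)) = (affine_line y, affine_plane (x / h y, y0))" for x y
    by (simp add: \<psi>_def cratio_affine_plane)
  have "continuous_on (U \<times> Fib) \<phi>"
  proof -
    have "U \<subseteq> chart 2" using affine_line_in_chart by (auto simp: U_def)
    then have cU: "continuous_on U (cratio 1 2)"
      using continuous_on_subset[OF continuous_on_cratio] by blast
    have 1: "continuous_on (U \<times> Fib) (\<lambda>p. cratio 1 2 (fst p))"
      by (rule continuous_on_compose2[OF cU continuous_on_fst[OF continuous_on_id]]) auto
    have 2: "continuous_on (U \<times> Fib) (\<lambda>p. cratio 1 3 (snd p))"
      by (rule continuous_on_compose2[OF cE continuous_on_snd[OF continuous_on_id], of Fib]) (auto simp: Fib_def)
    have 3: "continuous_on (U \<times> Fib) (\<lambda>p. h (cratio 1 2 (fst p)))"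
      by (rule continuous_on_compose2[OF h(1) 1]) (auto simp: U_def cratio_affine_line)
    have "continuous_on (U \<times> Fib) (\<lambda>p. (h (cratio 1 2 (fst p)) * cratio 1 3 (snd p), cratio 1 2 (fst p)))"
      by (rule continuous_on_Pair[OF continuous_on_mult[OF 3 2] 1])
    from continuous_on_compose2[OF continuous_on_affine_plane[of UNIV] this]
    show ?thesis unfolding \<phi>_def case_prod_beta by simp
  qed
  moreover have "\<phi> \<in> U \<times> Fib \<rightarrow> EU"
  proof clarify
    fix u e assume "u \<in> U" "e \<in> Fib"
    then obtain y x where "u = affine_line y" "y \<in> ?B" "e = affine_plane (x, y0)"
      "(x, y0) \<in> affine_complement m"
      unfolding U_def Fib by blast
    then show "\<phi> (u, e) \<in> EU" using hW EU \<phi> by metis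
  qed
  moreover have "continuous_on EU \<psi>"
  proof -
    have EUE: "EU \<subseteq> E" by (auto simp: EU_def)
    have 1: "continuous_on EU (\<lambda>q. h (cratio 2 3 q))"
      by (rule continuous_on_compose2[OF h(1) cE[OF EUE]]) (auto simp: EU cratio_affine_plane)
    have "continuous_on EU (\<lambda>q. (cratio 1 3 q / h (cratio 2 3 q), y0))"
      by (intro continuous_on_Pair continuous_on_divide cE[OF EUE] 1 continuous_on_const)
         (auto simp: EU cratio_affine_plane h(3))
    then have "continuous_on EU (\<lambda>q. affine_plane (cratio 1 3 q / h (cratio 2 3 q), y0))"
      by (rule continuous_on_compose2[OF continuous_on_affine_plane[of UNIV]]) simp
    moreover have "continuous_on EU (\<lambda>q. affine_line (cratio 2 3 q))"
      by (rule continuous_on_compose2[OF continuous_on_affine_line[of UNIV] cE[OF EUE]]) simp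
    ultimately show ?thesis unfolding \<psi>_def[abs_def] by (rule continuous_on_Pair[rotated])
  qed
  moreover have "\<psi> \<in> EU \<rightarrow> U \<times> Fib"
  proof
    fix q assume "q \<in> EU"
    then obtain x y where q: "q = affine_plane (x, y)" "y \<in> ?B" "(x, y) \<in> affine_complement m"
      using EU by blast
    then have "(x / h y, y0) \<in> affine_complement m" using hW[OF q(2), of "x / h y"] h(3) by simp
    then show "\<psi> q \<in> U \<times> Fib" using q by (auto simp: \<psi> Fib U_def)
  qed
  moreover have "\<psi> (\<phi> p) = p" if "p \<in> U \<times> Fib" for p
    using that h(3) by (auto simp: U_def Fib \<phi> \<psi>)
  moreover have "\<phi> (\<psi> q) = q" if "q \<in> EU" for q
    using that h(3) by (auto simp: EU \<phi> \<psi>)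
  ultimately have "homeomorphic_maps (top_of_set (U \<times> Fib)) (top_of_set EU) \<phi> \<psi>"
    by (simp add: homeomorphic_maps_def continuous_map_in_subtopology)
  then have "homeomorphic_map (top_of_set (U \<times> Fib)) (top_of_set EU) \<phi>"
    by (rule homeomorphic_maps_imp_map)
  moreover have "prod_topology (subtopology (top_of_set (\<pi> ` E)) U)
      (subtopology (top_of_set E) {e \<in> topspace (top_of_set E). \<pi> e = b}) = top_of_set (U \<times> Fib)"
  proof -
    have "\<pi> ` E \<inter> U = U" "E \<inter> {e \<in> E. \<pi> e = b} = Fib" using UE by (auto simp: Fib_def)
    then show ?thesis by (simp add: subtopology_subtopology)
  qed
  moreover have "subtopology (top_of_set E) {e \<in> topspace (top_of_set E). \<pi> e \<in> U} = top_of_set EU"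
  proof -
    have "E \<inter> {e \<in> E. \<pi> e \<in> U} = EU" by (auto simp: EU_def)
    then show ?thesis by (simp add: subtopology_subtopology)
  qed
  moreover have "openin (top_of_set (\<pi> ` E)) U"
    using UE open_affine_line_image[OF open_ball] by (simp add: U_def open_subset)
  moreover have "b \<in> U" using \<epsilon>(1) by (auto simp: U_def b)
  moreover have "\<forall>u\<in>U. \<forall>e\<in>topspace (top_of_set E). \<pi> e = b \<longrightarrow> \<pi> (\<phi> (u, e)) = u"
    by (auto simp: E U_def \<phi> \<pi>)
  ultimately show "\<exists>U \<phi>. openin (top_of_set (\<pi> ` E)) U \<and> b \<in> U \<and>
      homeomorphic_map
        (prod_topology (subtopology (top_of_set (\<pi> ` E)) U)
          (subtopology (top_of_set E) {e \<in> topspace (top_of_set E). \<pi> e = b}))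
        (subtopology (top_of_set E) {e \<in> topspace (top_of_set E). \<pi> e \<in> U}) \<phi> \<and>
      (\<forall>u\<in>U. \<forall>e\<in>topspace (top_of_set E). \<pi> e = b \<longrightarrow> \<pi> (\<phi> (u, e)) = u)"
    by (intro exI[of _ U] exI[of _ \<phi>]) simp
qed

text \<open>Homogeneity enters as a scaling law for values, which makes vanishing independent of the
  representative vector.\<close>

lemma proj_in_curve_iff:
  assumes scale: "\<And>c v. eval3 F (c *s v) = c ^ d * eval3 F v" and v: "v \<noteq> 0"
  shows "proj v \<in> curve F \<longleftrightarrow> eval3 F v = 0"
proof
  assume "proj v \<in> curve F"
  then obtain w where w: "proj v = proj w" "w \<noteq> 0" "eval3 F w = 0" by (auto simp: curve_def)
  then obtain c where "v = c *s w" using proj_eqE[OF v w(2,1)] by blast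
  then show "eval3 F v = 0" using w by (simp add: scale)
qed (use v in \<open>auto simp: curve_def\<close>)

lemma central_projection_from_x_axis:
  obtains \<pi> where "central_projection (proj (axis 1 1)) \<pi>"
    "\<And>x y. \<pi> (affine_plane (x, y)) = affine_line y"
proof -
  define A :: "complex ^ 3 ^ 2" where "A = (\<chi> i. if i = 1 then axis 2 1 else axis 3 1)"
  \<comment> \<open>Any choice of representative works: another one is a nonzero multiple, which the
    matrix carries along and \<open>proj\<close> forgets.\<close>
  define \<pi> where "\<pi> q = proj (A *v hom_coords q)" for q
  have A: "A *v v = (\<chi> i. if i = 1 then v $ 2 else v $ 3)" for v
    by (simp add: A_def matrix_vector_mult_def vec_eq_iff forall_2 sum_3 axis_def)
  have ker: "A *v v = 0 \<longleftrightarrow> v \<in> Rep_cproj (proj (axis 1 1))" for v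
  proof -
    have "A *v v = 0 \<longleftrightarrow> v $ 2 = 0 \<and> v $ 3 = 0"
      by (simp add: A vec_eq_iff forall_2)
    also have "\<dots> \<longleftrightarrow> (\<exists>c. v = c *s axis 1 1)"
      by (auto simp: vec_eq_iff forall_3 axis_def)
    finally show ?thesis by (simp add: Rep_cproj_proj axis_eq_0_iff image_iff)
  qed
  have \<pi>: "\<pi> (proj v) = proj (A *v v)" if "v \<notin> Rep_cproj (proj (axis 1 1))" for v
  proof -
    have "v \<noteq> 0" using that ker[of 0] by auto
    then obtain c where c: "c \<noteq> 0" "hom_coords (proj v) = c *s v" by (rule hom_coords_proj)
    then show ?thesis using proj_scale[OF c(1)] by (simp add: \<pi>_def vector_scalar_commute)
  qed
  show ?thesis
  proof (rule that)
    show "central_projection (proj (axis 1 1)) \<pi>"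
      unfolding central_projection_def using ker \<pi> by blast
    show "\<pi> (affine_plane (x, y)) = affine_line y" for x y
    proof -
      let ?v = "(\<chi> i. if i = 1 then x else if i = 2 then y else 1) :: complex ^ 3"
      have Av: "A *v ?v = (\<chi> i. if i = 1 then y else 1)" by (simp add: A vec_eq_iff forall_2)
      then have "A *v ?v \<noteq> 0" using affine_vector_nonzero(2) by simp
      then have "\<pi> (proj ?v) = proj (A *v ?v)" using \<pi> ker by blast
      then show ?thesis unfolding Av by (simp add: affine_plane_def affine_line_def cong: if_cong)
    qed
  qed
qed

lemma trivial_homotopy_group_affine_plane_image:
  assumes m: "m > 0" and n: "n \<ge> 2"
  shows "trivial_homotopy_group n (top_of_set (affine_plane ` affine_complement m)) a"
    (is "trivial_homotopy_group n (top_of_set ?X) a")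
proof -
  have factors: "\<exists>(C :: (complex \<times> complex) set) G F'. convex C \<and> continuous_on C G \<and> G ` C \<subseteq> ?X \<and>
      continuous_on (vector_cube n) F' \<and> F' ` vector_cube n \<subseteq> C \<and> (\<forall>v\<in>vector_cube n. G (F' v) = f v) \<and>
      (\<forall>S\<subseteq>vector_cube n. connected S \<and> f constant_on S \<longrightarrow> F' constant_on S)"
    if f: "continuous_on (vector_cube n) f" "f ` vector_cube n \<subseteq> ?X" for f
  proof -
    let ?K = "vector_cube n"
    define f' where "f' v = (cratio 1 3 (f v), cratio 2 3 (f v))" for v
    have "?X \<subseteq> chart 3" using affine_plane_in_chart by auto
    with f(2) have chart: "f ` ?K \<subseteq> chart 3" by (rule order_trans)
    have f': "continuous_on ?K f'"
      unfolding f'_def by (intro continuous_on_Pair continuous_on_compose2[OF continuous_on_cratio f(1) chart])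
    have ff': "affine_plane (f' v) = f v" if "v \<in> ?K" for v
      unfolding f'_def using chart that by (intro affine_plane_cratio) auto
    have "f' v \<in> affine_complement m" if "v \<in> ?K" for v
    proof -
      have "f v \<in> ?X" using f(2) that by (rule subsetD[OF _ imageI])
      then obtain p where "p \<in> affine_complement m" "f v = affine_plane p" by (elim imageE)
      then show ?thesis using ff'[OF that] affine_plane_eq_iff by simp
    qed
    then have f'W: "f' ` ?K \<subseteq> affine_complement m" by blast
    have ne: "?K \<noteq> {}" by (auto simp: vector_cube_def topspace_cube PiE_eq_empty_iff)
    obtain C :: "(complex \<times> complex) set" and G' F' where C: "convex C" "continuous_on C G'"
      "G' ` C \<subseteq> affine_complement m" "continuous_on ?K F'" "F' ` ?K \<subseteq> C" "\<And>v. v \<in> ?K \<Longrightarrow> G' (F' v) = f' v"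
      "\<And>S. \<lbrakk>connected S; S \<subseteq> ?K; f' constant_on S\<rbrakk> \<Longrightarrow> F' constant_on S"
      by (rule affine_complement_map_factors[OF m compact_vector_cube convex_vector_cube ne f' f'W])
         (rule that; (assumption | blast))
    show ?thesis
    proof (intro exI conjI ballI allI impI)
      show "convex C" "continuous_on ?K F'" "F' ` ?K \<subseteq> C" by (fact C)+
      show "continuous_on C (\<lambda>x. affine_plane (G' x))"
        by (rule continuous_on_compose2[OF continuous_on_affine_plane[of UNIV] C(2)]) simp
      show "(\<lambda>x. affine_plane (G' x)) ` C \<subseteq> ?X"
        using C(3) by blast
      show "affine_plane (G' (F' v)) = f v" if "v \<in> ?K" for v
        using C(6) ff' that by simp
      show "F' constant_on S" if "S \<subseteq> ?K" "connected S \<and> f constant_on S" for S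
      proof (rule C(7))
        show "f' constant_on S" using that(2) by (auto simp: constant_on_def f'_def)
      qed (use that in auto)
    qed
  qed
  show ?thesis
    by (rule trivial_homotopy_group_if_factors[OF factors n])
qed

theorem proposition1p12:
  fixes m :: nat and F :: cpoly3
  assumes "m \<ge> 2"
    and "F = varY * varZ * (varX ^ m * varY ^ m + varY ^ m * varZ ^ m + varX ^ m * varZ ^ m)
               * (varY ^ m + varZ ^ m)"
  shows "supersolvable F \<and> K_pi_1_space (top_of_set (curve_complement F))"
proof -
  have m: "m > 0" using assms(1) by simp
  have eval: "eval3 F v = v $ 2 * v $ 3 * ((v $ 1) ^ m * (v $ 2) ^ m + (v $ 2) ^ m * (v $ 3) ^ m
      + (v $ 1) ^ m * (v $ 3) ^ m) * ((v $ 2) ^ m + (v $ 3) ^ m)" for v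
    by (simp add: assms(2))
  have scale: "eval3 F (c *s v) = c ^ (3 * m + 2) * eval3 F v" for c v
    unfolding eval by (simp add: power_mult_distrib power_add power_mult power2_eq_square power3_eq_cube algebra_simps)
  have plane: "affine_plane (x, y) \<in> curve F \<longleftrightarrow> (x, y) \<notin> affine_complement m" for x y
  proof -
    have "affine_plane (x, y) \<in> curve F \<longleftrightarrow> y * (x ^ m * y ^ m + y ^ m + x ^ m) * (y ^ m + 1) = 0"
      unfolding affine_plane_def
      by (subst proj_in_curve_iff[OF scale]) (simp_all add: affine_vector_nonzero eval)
    also have "x ^ m * y ^ m + y ^ m + x ^ m = x ^ m * (y ^ m + 1) + y ^ m"
      by (simp add: algebra_simps)
    finally show ?thesis by (auto simp: affine_complement_def)
  qed
  have compl: "curve_complement F = affine_plane ` affine_complement m"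
  proof (intro equalityI subsetI)
    fix q assume q: "q \<in> curve_complement F"
    obtain v where v: "v \<noteq> 0" "q = proj v" by (rule proj_cases)
    then have "eval3 F v \<noteq> 0" using q proj_in_curve_iff[OF scale] by (simp add: curve_complement_def)
    \<comment> \<open>The factor \<open>z\<close> of the equation removes the line at infinity, so
      the whole complement lies in one chart.\<close>
    then have "v $ 3 \<noteq> 0" by (auto simp: eval)
    then have "q = affine_plane (cratio 1 3 q, cratio 2 3 q)"
      using v by (simp add: affine_plane_cratio proj_in_chart_iff)
    then show "q \<in> affine_plane ` affine_complement m"
      using q plane by (metis ComplD curve_complement_def image_eqI)
  qed (auto simp: plane curve_complement_def)

  \<comment> \<open>The degree is left unsimplified so that it mirrors the product and the closure
    rules apply directly.\<close>
  have "homogeneous3 (1 + 1 + (m * 1 + m * 1) + m * 1) F"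
    unfolding assms(2)
    by (intro homogeneous3_mult homogeneous3_add homogeneous3_power homogeneous3_vars)
  then have "reduced_plane_curve F"
    unfolding reduced_plane_curve_def
    using cpoly3_factor_squarefree[OF m] by (auto simp: assms(2) intro!: exI[of _ "1 + 1 + (m * 1 + m * 1) + m * 1"])
  moreover have "modular_point F (proj (axis 1 1))"
  proof -
    have "proj (axis 1 1) \<in> curve F"
      using proj_in_curve_iff[OF scale, of "axis 1 1"]
      by (simp add: axis_eq_0_iff eval) (simp add: axis_def)
    moreover obtain \<pi> where "central_projection (proj (axis 1 1)) \<pi>"
      "\<And>x y. \<pi> (affine_plane (x, y)) = affine_line y"
      using central_projection_from_x_axis by blast
    ultimately show ?thesis
      unfolding modular_point_def using locally_trivial_affine_complement[OF m compl] by blast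
  qed
  moreover have "K_pi_1_space (top_of_set (curve_complement F))"
    unfolding K_pi_1_space_def
  proof (intro conjI allI impI ballI)
    have "(0, 1) \<in> affine_complement m" using m by (simp add: affine_complement_def zero_power)
    then show "topspace (top_of_set (curve_complement F)) \<noteq> {}" by (auto simp: compl)
    show "path_connected_space (top_of_set (curve_complement F))"
      using path_connected_continuous_image[OF continuous_on_affine_plane path_connected_affine_complement]
      unfolding compl path_connectedin_euclidean[symmetric] path_connectedin_def by blast
    fix n :: nat and a assume n: "n \<ge> 2"
    then show "trivial_homotopy_group n (top_of_set (curve_complement F)) a"
      unfolding compl by (rule trivial_homotopy_group_affine_plane_image[OF m])
  qed
  ultimately show ?thesis by (auto simp: supersolvable_def)
qed

end
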